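(* There exists an infinite family of $\mathbb{Z}$-colorable pretzel links each of which has a minimal diagram admitting a $\mathbb{Z}$-coloring with only four colors (that is, a $\mathbb{Z}$-coloring whose image has exactly four elements).
   Context: Links are links in the 3-space, and diagrams are regular diagrams; an arc of a diagram runs from undercrossing to undercrossing. Let $D$ be a diagram of a link. A map $\gamma$ from the set of arcs of $D$ to $\mathbb{Z}$ is called a $\mathbb{Z}$-coloring on $D$ if $2\gamma(a)=\gamma(b)+\gamma(c)$ holds at each crossing of $D$ with over arc $a$ and under arcs $b$ and $c$. The integers in the image of $\gamma$ are called the colors of $\gamma$. A $\mathbb{Z}$-coloring is trivial if it assigns the same integer to all arcs, and non-trivial otherwise. A link is $\mathbb{Z}$-colorable if it has a diagram admitting a non-trivial $\mathbb{Z}$-coloring. A minimal diagram of a link is a diagram representing the link with the least number of crossings among all diagrams of the link. A pretzel link $P(a_1,\dots,a_m)$ is a link admitting a diagram consisting of rational tangles corresponding to $1/a_1,1/a_2,\dots,1/a_m$ located in line; that is, $m$ vertical twisted strands (columns) placed side by side, the $i$-th having $|a_i|$ crossings twisted in the direction given by the sign of $a_i$, with adjacent columns (and the last with the first) joined at top and bottom in the standard way. *)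

theory Defs
  imports "HOL-Analysis.Analysis"
begin

section \<open>Links in 3-space\<close>

text \<open>Links are tame and unoriented. They are treated as point sets: a link is a set that is
  ambient isotopic to a disjoint union of finitely many simple closed polygons.\<close>

definition polygon_edge :: "(real^3) list \<Rightarrow> nat \<Rightarrow> (real^3) set" where
  "polygon_edge vs i = closed_segment (vs ! i) (vs ! (Suc i mod length vs))"

definition closed_polygon :: "(real^3) list \<Rightarrow> (real^3) set" where
  "closed_polygon vs = (\<Union>i<length vs. polygon_edge vs i)"

definition simple_polygon :: "(real^3) list \<Rightarrow> bool" where
  "simple_polygon vs \<longleftrightarrow> 3 \<le> length vs \<and> distinct vs \<and>
     (\<forall>i<length vs. \<forall>j<length vs. i \<noteq> j \<longrightarrow>
        polygon_edge vs i \<inter> polygon_edge vs j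
          \<subseteq> {vs ! i, vs ! (Suc i mod length vs)} \<inter> {vs ! j, vs ! (Suc j mod length vs)})"

definition polygonal_link :: "(real^3) list set \<Rightarrow> bool" where
  "polygonal_link P \<longleftrightarrow> finite P \<and> P \<noteq> {} \<and> (\<forall>vs\<in>P. simple_polygon vs) \<and>
     pairwise (\<lambda>vs ws. disjnt (closed_polygon vs) (closed_polygon ws)) P"

definition carrier_set :: "(real^3) list set \<Rightarrow> (real^3) set" where
  "carrier_set P = (\<Union>vs\<in>P. closed_polygon vs)"

text \<open>The intermediate maps of the homotopy from the identity are required to be
  self-homeomorphisms of the space, so this is ambient isotopy.\<close>

definition ambient_isotopic :: "(real^3) set \<Rightarrow> (real^3) set \<Rightarrow> bool" where
  "ambient_isotopic L L' \<longleftrightarrow>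
     (\<exists>h. homotopic_with_canon (\<lambda>f. \<exists>g. homeomorphism UNIV UNIV f g) UNIV UNIV id h \<and> h ` L = L')"

definition link :: "(real^3) set \<Rightarrow> bool" where
  "link L \<longleftrightarrow> (\<exists>P. polygonal_link P \<and> ambient_isotopic (carrier_set P) L)"

section \<open>Regular diagrams\<close>

text \<open>A diagram is given by a polygonal link in regular position with respect to the projection
  along the third axis; the third coordinate carries the over/under information.\<close>

definition proj :: "real^3 \<Rightarrow> real \<times> real" where
  "proj x = (x $ 1, x $ 2)"

text \<open>A crossing is recorded as the pair of its over point and its under point. Two distinct
  points with the same projection differ in height, so in regular position crossings
  correspond one-to-one to the double points of the projection.\<close>

definition crossings :: "(real^3) set \<Rightarrow> ((real^3) \<times> (real^3)) set" where
  "crossings D = {(p, u). p \<in> D \<and> u \<in> D \<and> proj p = proj u \<and> u $ 3 < p $ 3}"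

text \<open>Regular position in the sense of Crowell and Fox: there are finitely many multiple points,
  all of them are double points, and none of them is the image of a vertex. Hence crossings
  are transversal crossings of edge interiors, and no edge is parallel to the third axis.\<close>

definition regular_position :: "(real^3) list set \<Rightarrow> bool" where
  "regular_position P \<longleftrightarrow> finite (crossings (carrier_set P)) \<and>
     (\<forall>(p, u) \<in> crossings (carrier_set P).
        {x \<in> carrier_set P. proj x = proj p} = {p, u} \<and>
        (\<forall>vs\<in>P. p \<notin> set vs \<and> u \<notin> set vs))"

definition diagram :: "(real^3) set \<Rightarrow> bool" where
  "diagram D \<longleftrightarrow> (\<exists>P. polygonal_link P \<and> regular_position P \<and> D = carrier_set P)"

definition diagram_of :: "(real^3) set \<Rightarrow> (real^3) set \<Rightarrow> bool" where
  "diagram_of D L \<longleftrightarrow> diagram D \<and> ambient_isotopic D L"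

definition minimal_diagram :: "(real^3) set \<Rightarrow> (real^3) set \<Rightarrow> bool" where
  "minimal_diagram D L \<longleftrightarrow> diagram_of D L \<and>
     (\<forall>D'. diagram_of D' L \<longrightarrow> card (crossings D) \<le> card (crossings D'))"

section \<open>Colorings by integers\<close>

text \<open>Arcs are obtained by cutting the diagram at its under points. A closed component
  without under points is a single arc.\<close>

definition arcs :: "(real^3) set \<Rightarrow> (real^3) set set" where
  "arcs D = components (D - snd ` crossings D)"

text \<open>The arcs ending at an under point \<open>u\<close> are those having \<open>u\<close> in their closure. There are two
  of them, or only one if both ends belong to the same arc; in the latter case \<open>b = c\<close> below.
  Only the values of \<open>\<gamma>\<close> on the arcs matter.\<close>

definition Z_coloring :: "(real^3) set \<Rightarrow> ((real^3) set \<Rightarrow> int) \<Rightarrow> bool" where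
  "Z_coloring D \<gamma> \<longleftrightarrow>
     (\<forall>(p, u) \<in> crossings D. \<forall>a\<in>arcs D. \<forall>b\<in>arcs D. \<forall>c\<in>arcs D.
        p \<in> a \<and> {A \<in> arcs D. u \<in> closure A} = {b, c} \<longrightarrow> 2 * \<gamma> a = \<gamma> b + \<gamma> c)"

definition colors :: "(real^3) set \<Rightarrow> ((real^3) set \<Rightarrow> int) \<Rightarrow> int set" where
  "colors D \<gamma> = \<gamma> ` arcs D"

definition trivial_coloring :: "(real^3) set \<Rightarrow> ((real^3) set \<Rightarrow> int) \<Rightarrow> bool" where
  "trivial_coloring D \<gamma> \<longleftrightarrow> (\<forall>a\<in>arcs D. \<forall>b\<in>arcs D. \<gamma> a = \<gamma> b)"

definition Z_colorable :: "(real^3) set \<Rightarrow> bool" where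
  "Z_colorable L \<longleftrightarrow>
     (\<exists>D \<gamma>. diagram_of D L \<and> Z_coloring D \<gamma> \<and> \<not> trivial_coloring D \<gamma>)"

section \<open>Pretzel links\<close>

text \<open>The column with index \<open>j\<close> and parameter \<open>a\<close> projects into the strip
  \<open>2 j \<le> x \<le> 2 j + 1\<close> and has one crossing between the levels \<open>k\<close> and \<open>Suc k\<close> for each
  \<open>k < \<bar>a\<bar>\<close>. The left strand ends have height \<open>0\<close> and the right ones height \<open>sgn a * k\<close>. So the
  strand rising from left to right has height \<open>sgn a * (k + 1) / 2\<close> at the crossing and the
  other one \<open>sgn a * k / 2\<close>: the former is the over strand at every crossing of the column if
  \<open>a > 0\<close>, and the under strand at every crossing if \<open>a < 0\<close>.\<close>

definition left_end :: "nat \<Rightarrow> nat \<Rightarrow> real^3" where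
  "left_end j k = vector [2 * real j, real k, 0]"

definition right_end :: "nat \<Rightarrow> int \<Rightarrow> nat \<Rightarrow> real^3" where
  "right_end j a k = vector [2 * real j + 1, real k, of_int (sgn a) * real k]"

definition column :: "nat \<Rightarrow> int \<Rightarrow> (real^3) set" where
  "column j a = (\<Union>k<nat \<bar>a\<bar>.
     closed_segment (left_end j k) (right_end j a (Suc k)) \<union>
     closed_segment (right_end j a k) (left_end j (Suc k)))"

text \<open>Adjacent columns are joined by one segment at the top and one at the bottom. The last column
  is joined to the first one by a polygonal path running above all columns and one running
  below all columns.\<close>

definition pretzel :: "int list \<Rightarrow> (real^3) set" where
  "pretzel as =
    (let m = length as; h = (\<lambda>j. nat \<bar>as ! j\<bar>); x = 2 * real m - 1; y = 1 + (\<Sum>j<m. real (h j)) in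
      (\<Union>j<m. column j (as ! j)) \<union>
      (\<Union>j<m - 1.
         closed_segment (right_end j (as ! j) (h j)) (left_end (Suc j) (h (Suc j))) \<union>
         closed_segment (right_end j (as ! j) 0) (left_end (Suc j) 0)) \<union>
      closed_segment (right_end (m - 1) (as ! (m - 1)) (h (m - 1))) (vector [x, y, 0]) \<union>
      closed_segment (vector [x, y, 0]) (vector [0, y, 0]) \<union>
      closed_segment (vector [0, y, 0]) (left_end 0 (h 0)) \<union>
      closed_segment (right_end (m - 1) (as ! (m - 1)) 0) (vector [x, -1, 0]) \<union>
      closed_segment (vector [x, -1, 0]) (vector [0, -1, 0]) \<union>
      closed_segment (vector [0, -1, 0]) (left_end 0 0))"

text \<open>Parameters are nonzero, since the \<open>i\<close>-th column is the rational tangle \<open>1 / a\<^sub>i\<close>.\<close>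

definition pretzel_link :: "(real^3) set \<Rightarrow> bool" where
  "pretzel_link L \<longleftrightarrow> link L \<and>
     (\<exists>as. as \<noteq> [] \<and> 0 \<notin> set as \<and> ambient_isotopic (pretzel as) L)"

end

theory Submission
  imports Defs
begin

text \<open>The family consists of the pretzel links \<open>P(2, -2, 2, -2, \<dots>, 2, -2)\<close> with an even
  number \<open>m \<ge> 4\<close> of columns. Each column has two crossings, so the right strand of one column and
  the left strand of the next one close up: the link is a cyclic chain of \<open>m\<close> rings, in which
  neighbours are linked once. The diagram is the standard pretzel diagram, with \<open>2 m\<close> crossings.

  \<^emph>\<open>Coloring.\<close> A ring takes part in two columns, of opposite twist, and passes under its neighbours
  once in each. Both under points are at the same level, namely in the lower half of the columns for
  rings of even index and in the upper half for rings of odd index. So each ring consists of two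
  arcs. Coloring a ring \<open>0\<close> below and \<open>2\<close> above its under points if its index is even, and \<open>1\<close> below
  and \<open>3\<close> above if it is odd, gives \<open>2 \<cdot> 1 = 0 + 2\<close> at the lower crossings and \<open>2 \<cdot> 2 = 1 + 3\<close> at the
  upper ones (\<open>Z_coloring_arc_color\<close>).

  \<^emph>\<open>Minimality.\<close> Let \<open>A\<close> and \<open>B\<close> be two components of any diagram. If \<open>A\<close> never passes under \<open>B\<close>,
  it can be lifted away from \<open>B\<close> and then shrunk to a point, all in the complement of \<open>B\<close>; likewise
  it can be lowered if it never passes over \<open>B\<close> (\<open>contractible_off_lift\<close>). Contractibility in the
  complement is invariant under homeomorphisms of the space, and it fails for neighbouring rings of
  the chain: every ring but the last is the zero set of a map from the space to the complex plane, and
  its neighbour is mapped to a curve that turns once around \<open>0\<close>, along which there is no continuous logarithm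
  (\<open>triangle_not_contractible_off\<close>). Hence, in every diagram, neighbouring rings pass both over and
  under each other. These \<open>2 m\<close> pairs of an over ring and an under ring are distinct because
  \<open>m \<ge> 3\<close>, so there are at least \<open>2 m\<close> crossings (\<open>crossings_lower_bound\<close>).

  \<^emph>\<open>Infinitely many links.\<close> The bound shows that \<open>2 m\<close> is the minimal crossing number, so different
  values of \<open>m\<close> give links that are not ambient isotopic.\<close>

section \<open>Contracting a set in the complement of another set\<close>

text \<open>A contraction of the inclusion of \<open>A\<close> as a point set. For a closed curve \<open>A\<close> this replaces a
  null homotopy of a parametrized loop.\<close>

definition contractible_off :: "'a::real_normed_vector set \<Rightarrow> 'a set \<Rightarrow> bool" where
  "contractible_off A B \<longleftrightarrow> (\<exists>c. homotopic_with_canon (\<lambda>_. True) A (- B) id (\<lambda>_. c))"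

lemma contractible_off_homeomorphism:
  fixes h g :: "'a::real_normed_vector \<Rightarrow> 'a"
  assumes hom: "homeomorphism UNIV UNIV h g" and contr: "contractible_off (h ` A) (h ` B)"
  shows "contractible_off A B"
proof -
  obtain c where "homotopic_with_canon (\<lambda>_. True) (h ` A) (- h ` B) id (\<lambda>_. c)"
    using contr unfolding contractible_off_def by blast
  moreover have "continuous_on (- h ` B) g" "g \<in> (- h ` B) \<rightarrow> - B"
    using hom by (auto simp: homeomorphism_def intro: continuous_on_subset) (metis image_eqI)
  ultimately have "homotopic_with_canon (\<lambda>_. True) (h ` A) (- B) (g \<circ> id) (g \<circ> (\<lambda>_. c))"
    by (rule homotopic_with_compose_continuous_left)
  moreover have "continuous_on A h"
    using hom by (auto simp: homeomorphism_def intro: continuous_on_subset)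
  ultimately have "homotopic_with_canon (\<lambda>_. True) A (- B) ((g \<circ> id) \<circ> h) ((g \<circ> (\<lambda>_. c)) \<circ> h)"
    by (rule homotopic_with_compose_continuous_right) auto
  moreover have "(g \<circ> id) \<circ> h = id" "(g \<circ> (\<lambda>_. c)) \<circ> h = (\<lambda>_. g c)"
    using hom by (auto simp: homeomorphism_def)
  ultimately show ?thesis
    unfolding contractible_off_def by auto
qed

text \<open>A vertical translation of \<open>A\<close> away from \<open>B\<close> does not meet \<open>B\<close>, since on every vertical line \<open>A\<close>
  is already on the side towards which it moves. Once \<open>A\<close> is beyond all of \<open>B\<close>, it shrinks to a
  point within a half-space. Translation is upwards for \<open>\<sigma> = 1\<close> and downwards for \<open>\<sigma> = -1\<close>.\<close>

lemma contractible_off_lift: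
  fixes A B :: "(real^3) set"
  assumes "compact A" "compact B" and \<sigma>: "\<sigma> = 1 \<or> \<sigma> = -1"
    and above: "\<And>a b. a \<in> A \<Longrightarrow> b \<in> B \<Longrightarrow> proj a = proj b \<Longrightarrow> \<sigma> * b $ 3 < \<sigma> * a $ 3"
  shows "contractible_off A B"
proof -
  define e :: "real^3" where "e = \<sigma> *\<^sub>R axis 3 1"
  have e [simp]: "e $ 1 = 0" "e $ 2 = 0" "e $ 3 = \<sigma>"
    by (simp_all add: e_def axis_def)
  have \<sigma>\<sigma>: "\<sigma> * \<sigma> = 1" using \<sigma> by auto
  obtain KA where KA: "\<And>a. a \<in> A \<Longrightarrow> norm a \<le> KA"
    using \<open>compact A\<close> compact_imp_bounded bounded_iff by metis
  obtain KB where KB: "\<And>b. b \<in> B \<Longrightarrow> norm b \<le> KB"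
    using \<open>compact B\<close> compact_imp_bounded bounded_iff by metis
  define K where "K = \<bar>KA\<bar> + \<bar>KB\<bar> + 1"
  define c where "c = K *\<^sub>R e"
  have lo: "- \<bar>KA\<bar> \<le> \<sigma> * a $ 3" if "a \<in> A" for a
    using KA[OF that] component_le_norm_cart[of a 3] \<sigma> by auto
  have hi: "\<sigma> * b $ 3 \<le> \<bar>KB\<bar>" if "b \<in> B" for b
    using KB[OF that] component_le_norm_cart[of b 3] \<sigma> by auto
  have "homotopic_with_canon (\<lambda>_. True) A (- B) id (\<lambda>x. x + c)"
  proof (rule homotopic_with_linear)
    fix x assume x: "x \<in> A"
    show "closed_segment (id x) (x + c) \<subseteq> - B"
    proof (clarsimp simp: closed_segment_def)
      fix t :: real assume t: "0 \<le> t" and b: "(1 - t) *\<^sub>R x + t *\<^sub>R (x + c) \<in> B"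
      have eq: "(1 - t) *\<^sub>R x + t *\<^sub>R (x + c) = x + (t * K) *\<^sub>R e"
        by (simp add: c_def algebra_simps)
      have "proj x = proj (x + (t * K) *\<^sub>R e)" by (simp add: proj_def)
      from above[OF x b[unfolded eq] this] have "t * K * (\<sigma> * \<sigma>) < 0"
        by (simp add: algebra_simps)
      moreover have "0 \<le> t * K" using t by (simp add: K_def)
      ultimately show False by (simp add: \<sigma>\<sigma>)
    qed
  qed (auto intro!: continuous_intros)
  moreover have "homotopic_with_canon (\<lambda>_. True) A (- B) (\<lambda>x. x + c) (\<lambda>_. c)"
  proof (rule homotopic_with_linear)
    fix x assume x: "x \<in> A"
    show "closed_segment (x + c) c \<subseteq> - B"
    proof (clarsimp simp: closed_segment_def)
      fix t :: real assume t: "0 \<le> t" "t \<le> 1" and b: "(1 - t) *\<^sub>R (x + c) + t *\<^sub>R c \<in> B"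
      have eq: "(1 - t) *\<^sub>R (x + c) + t *\<^sub>R c = (1 - t) *\<^sub>R x + K *\<^sub>R e"
        by (simp add: c_def algebra_simps)
      have "(1 - t) * (\<sigma> * x $ 3) + K * (\<sigma> * \<sigma>) \<le> \<bar>KB\<bar>"
        using hi[OF b[unfolded eq]] by (simp add: algebra_simps)
      moreover have "(1 - t) * (\<sigma> * x $ 3) \<ge> (1 - t) * - \<bar>KA\<bar>"
        using lo[OF x] t by (intro mult_left_mono) auto
      moreover have "(1 - t) * \<bar>KA\<bar> \<le> 1 * \<bar>KA\<bar>"
        using t by (intro mult_right_mono) auto
      ultimately show False by (simp add: \<sigma>\<sigma> K_def)
    qed
  qed (auto intro!: continuous_intros)
  ultimately show ?thesis
    unfolding contractible_off_def using homotopic_with_trans by blast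
qed

text \<open>The obstruction to contractibility: composing the contraction with \<open>f\<close> makes \<open>f\<close> inessential
  on \<open>A\<close> as a map to the punctured plane.\<close>

lemma contractible_off_imp_log:
  fixes f :: "'a::real_normed_vector \<Rightarrow> complex"
  assumes "contractible_off A B" "continuous_on (- B) f" "\<And>x. x \<notin> B \<Longrightarrow> f x \<noteq> 0"
  obtains G where "continuous_on A G" "\<And>x. x \<in> A \<Longrightarrow> f x = exp (G x)"
proof -
  obtain c where "homotopic_with_canon (\<lambda>_. True) A (- B) id (\<lambda>_. c)"
    using assms(1) unfolding contractible_off_def by blast
  moreover note assms(2)
  moreover have "f \<in> (- B) \<rightarrow> - {0}" using assms(3) by auto
  ultimately have "homotopic_with_canon (\<lambda>_. True) A (- {0}) (f \<circ> id) (f \<circ> (\<lambda>_. c))"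
    by (rule homotopic_with_compose_continuous_left)
  then have "\<exists>a. homotopic_with_canon (\<lambda>_. True) A (- {0}) f (\<lambda>_. a)"
    by (auto simp: comp_def)
  then show ?thesis
    unfolding inessential_eq_continuous_logarithm using that by blast
qed

text \<open>Both \<open>G\<close> and the principal logarithm of \<open>w * f\<close> lift \<open>f\<close> through the exponential function, up to
  the constant factor \<open>w\<close>, so their difference is locally constant. The factor \<open>w\<close> serves to rotate
  the image of \<open>S\<close> off the branch cut.\<close>

lemma log_branch_difference:
  fixes f G :: "'a::topological_space \<Rightarrow> complex"
  assumes "connected S" "continuous_on S G" and exp: "\<And>x. x \<in> S \<Longrightarrow> f x = exp (G x)"
    and "w \<noteq> 0" and slit: "\<And>x. x \<in> S \<Longrightarrow> w * f x \<notin> \<real>\<^sub>\<le>\<^sub>0" and "a \<in> S" "b \<in> S"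
  shows "G b - G a = Ln (w * f b) - Ln (w * f a)"
proof -
  define k where "k x = Ln (w * f x) - G x" for x
  have contf: "continuous_on S f"
    using continuous_on_exp[OF assms(2)] by (rule continuous_on_eq) (simp add: exp)
  have contk: "continuous_on S k"
    unfolding k_def using slit assms(2) contf
    by (intro continuous_intros continuous_on_Ln') auto
  have expk: "exp (k x) = w" if "x \<in> S" for x
    using \<open>w \<noteq> 0\<close> by (simp add: k_def exp_diff exp[OF that])
  have "k constant_on S"
  proof (rule continuous_discrete_range_constant[OF \<open>connected S\<close> contk])
    fix x assume x: "x \<in> S"
    have "2 * pi \<le> norm (k y - k x)" if "y \<in> S" "k y \<noteq> k x" for y
    proof -
      have "exp (k y) = exp (k x)" using expk x that by simp
      then obtain n :: int where n: "k y = k x + (of_int (2 * n) * pi) * \<i>"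
        using exp_eq by blast
      then have "n \<noteq> 0" using that by auto
      then have "1 \<le> \<bar>real_of_int n\<bar>" by linarith
      moreover have "norm (k y - k x) = 2 * \<bar>real_of_int n\<bar> * pi"
        using n by (simp add: norm_mult)
      ultimately show ?thesis by (simp add: mult_le_cancel_right1 pi_gt_zero)
    qed
    then show "\<exists>e>0. \<forall>y. y \<in> S \<and> k y \<noteq> k x \<longrightarrow> e \<le> norm (k y - k x)"
      by (intro exI[of _ "2 * pi"]) auto
  qed
  then have "k a = k b" using assms(6,7) unfolding constant_on_def by metis
  then show ?thesis by (simp add: k_def algebra_simps)
qed

text \<open>The segments from \<open>P\<close> to \<open>M\<close> and from \<open>M\<close> to \<open>Q\<close> are mapped to the segments
  from \<open>1 - \<tau> \<i>\<close> to \<open>-1\<close> and from \<open>-1\<close> to \<open>1 + \<tau> \<i>\<close>, and \<open>T\<close> leads back within the right half-plane.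
  So the image winds once around \<open>0\<close>. The imaginary part of a continuous logarithm would change in
  the same direction along each of the three pieces, although the total change has to vanish.\<close>

lemma triangle_not_contractible_off:
  fixes f :: "'a::real_normed_vector \<Rightarrow> complex"
  assumes contf: "continuous_on UNIV f" and B: "\<And>x. f x = 0 \<Longrightarrow> x \<in> B"
    and conn: "connected T" and Tpos: "\<And>x. x \<in> T \<Longrightarrow> 0 < Re (f x)" and PQ: "P \<in> T" "Q \<in> T"
    and A: "closed_segment P M \<union> closed_segment M Q \<union> T \<subseteq> A"
    and \<tau>: "\<tau> = 1 \<or> \<tau> = -1"
    and f1: "\<And>t. 0 \<le> t \<Longrightarrow> t \<le> 1 \<Longrightarrow>
      f ((1 - t) *\<^sub>R P + t *\<^sub>R M) = Complex (1 - 2 * t) (- \<tau> * (1 - t))"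
    and f2: "\<And>t. 0 \<le> t \<Longrightarrow> t \<le> 1 \<Longrightarrow>
      f ((1 - t) *\<^sub>R M + t *\<^sub>R Q) = Complex (2 * t - 1) (\<tau> * t)"
  shows "\<not> contractible_off A B"
proof
  assume "contractible_off A B"
  then obtain G where G: "continuous_on A G" "\<And>x. x \<in> A \<Longrightarrow> f x = exp (G x)"
    using contractible_off_imp_log[of A B f] contf B by (metis continuous_on_subset subset_UNIV)
  have fP: "f P = Complex 1 (- \<tau>)" using f1[of 0] by simp
  have fM: "f M = -1" using f1[of 1] by (simp add: complex_eq_iff)
  have fQ: "f Q = Complex 1 \<tau>" using f2[of 1] by simp
  note nonpos = complex_nonpos_Reals_iff
  have T: "G P - G Q = Ln (1 * f P) - Ln (1 * f Q)"
    using A by (intro log_branch_difference[of T]) 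
      (use conn G Tpos PQ in \<open>auto simp: nonpos intro: continuous_on_subset dest: Tpos\<close>)
  \<comment> \<open>The factor \<open>\<tau> \<i>\<close> rotates the image of the first segment into the closed right half-plane minus \<open>0\<close>.\<close>
  have S1: "G M - G P = Ln (Complex 0 \<tau> * f M) - Ln (Complex 0 \<tau> * f P)"
  proof (rule log_branch_difference[of "closed_segment P M"])
    fix x assume "x \<in> closed_segment P M"
    then obtain t where "0 \<le> t" "t \<le> 1" "x = (1 - t) *\<^sub>R P + t *\<^sub>R M"
      by (auto simp: closed_segment_def)
    then show "Complex 0 \<tau> * f x \<notin> \<real>\<^sub>\<le>\<^sub>0"
      using f1[of t] \<tau> by (auto simp: nonpos)
  qed (use A G \<tau> in \<open>auto simp: complex_eq_iff intro: continuous_on_subset\<close>)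
  \<comment> \<open>The factor \<open>- \<tau> \<i>\<close> does the same for the second segment.\<close>
  have S2: "G Q - G M = Ln (Complex 0 (-\<tau>) * f Q) - Ln (Complex 0 (-\<tau>) * f M)"
  proof (rule log_branch_difference[of "closed_segment M Q"])
    fix x assume "x \<in> closed_segment M Q"
    then obtain t where "0 \<le> t" "t \<le> 1" "x = (1 - t) *\<^sub>R M + t *\<^sub>R Q"
      by (auto simp: closed_segment_def)
    then show "Complex 0 (-\<tau>) * f x \<notin> \<real>\<^sub>\<le>\<^sub>0"
      using f2[of t] \<tau> by (auto simp: nonpos)
  qed (use A G \<tau> in \<open>auto simp: complex_eq_iff intro: continuous_on_subset\<close>)
  have "Ln (Complex 1 (-\<tau>)) - Ln (Complex 1 \<tau>) + (Ln (Complex 0 (-\<tau>)) - Ln (Complex 1 \<tau>))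
    + (Ln (Complex 1 (-\<tau>)) - Ln (Complex 0 \<tau>)) = 0"
  proof -
    have "Complex 0 \<tau> * f M = Complex 0 (-\<tau>)" "Complex 0 (-\<tau>) * f M = Complex 0 \<tau>"
      "Complex 0 \<tau> * f P = Complex 1 \<tau>" "Complex 0 (-\<tau>) * f Q = Complex 1 (-\<tau>)"
      using \<tau> by (auto simp: fM fP fQ complex_eq_iff)
    then have "Ln (Complex 1 (-\<tau>)) - Ln (Complex 1 \<tau>) + (Ln (Complex 0 (-\<tau>)) - Ln (Complex 1 \<tau>))
      + (Ln (Complex 1 (-\<tau>)) - Ln (Complex 0 \<tau>)) = (G P - G Q) + (G M - G P) + (G Q - G M)"
      unfolding T S1 S2 by (simp add: fP fQ)
    then show ?thesis by simp
  qed
  then have sum0: "Im (Ln (Complex 1 (-\<tau>))) - Im (Ln (Complex 1 \<tau>))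
    + (Im (Ln (Complex 0 (-\<tau>))) - Im (Ln (Complex 1 \<tau>)))
    + (Im (Ln (Complex 1 (-\<tau>))) - Im (Ln (Complex 0 \<tau>))) = 0"
    by (simp add: complex_eq_iff)
  have pos: "0 < Im (Ln z)" if "0 < Im z" for z
    using Im_Ln_pos_lt_imp that by blast
  have neg: "Im (Ln z) < 0" if "Im z < 0" for z
    using Im_Ln_pos_le[of z] Im_Ln_le_pi[of z] that by (cases "z = 0") force+
  show False
    using \<tau> sum0 pos[of "Complex 1 1"] pos[of "Complex 0 1"] neg[of "Complex 1 (-1)"] neg[of "Complex 0 (-1)"]
    by auto
qed

section \<open>The pretzel with alternating columns of two crossings\<close>

lemma vec3_eq_iff: "p = q \<longleftrightarrow> p $ 1 = q $ 1 \<and> p $ 2 = q $ 2 \<and> p $ 3 = q $ 3" for p q :: "'a^3"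
  by (simp add: vec_eq_iff forall_3)

text \<open>A segment that is not orthogonal to an axis is a graph over that axis. In this form
  incidences between edges become questions of linear arithmetic.\<close>

lemma closed_segment_over_axis:
  fixes a b :: "real^'n"
  assumes "a $ i < b $ i"
  shows "closed_segment a b = {p. a $ i \<le> p $ i \<and> p $ i \<le> b $ i \<and>
      (\<forall>k. (b $ i - a $ i) * (p $ k - a $ k) = (b $ k - a $ k) * (p $ i - a $ i))}" (is "?S = ?T")
proof (intro set_eqI iffI)
  fix p assume "p \<in> ?S"
  then obtain t where t: "0 \<le> t" "t \<le> 1" and p: "p = a + t *\<^sub>R (b - a)"
    by (auto simp: closed_segment_def algebra_simps)
  have "p $ i = a $ i + t * (b $ i - a $ i)" using p by simp
  moreover have "t * (b $ i - a $ i) \<le> b $ i - a $ i" "0 \<le> t * (b $ i - a $ i)"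
    using t assms by (auto simp: mult_left_le_one_le)
  ultimately have "a $ i \<le> p $ i" "p $ i \<le> b $ i" by linarith+
  moreover have "(b $ i - a $ i) * (p $ k - a $ k) = (b $ k - a $ k) * (p $ i - a $ i)" for k
    by (simp add: p)
  ultimately show "p \<in> ?T" by blast
next
  fix p assume p: "p \<in> ?T"
  define t where "t = (p $ i - a $ i) / (b $ i - a $ i)"
  have t: "0 \<le> t" "t \<le> 1" using p assms by (auto simp: t_def)
  have "p $ k = a $ k + t * (b $ k - a $ k)" for k
  proof -
    have "(b $ i - a $ i) * (p $ k - a $ k) = (b $ k - a $ k) * (p $ i - a $ i)" using p by blast
    then show ?thesis using assms by (simp add: t_def field_simps)
  qed
  then have "p = a + t *\<^sub>R (b - a)" by (simp add: vec_eq_iff)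
  then show "p \<in> ?S" using t by (auto simp: closed_segment_def algebra_simps)
qed

definition twist :: "nat \<Rightarrow> real" where
  "twist j = (if even j then 1 else - 1)"

lemma twist_cases: "twist j = 1 \<or> twist j = -1"
  by (simp add: twist_def)

lemma twist_Suc: "twist (Suc j) = - twist j"
  by (simp add: twist_def)

text \<open>The two strands of a column with two crossings are zigzags that start at its lower left and at its
  lower right end. Both are graphs over the second coordinate, which runs from \<open>0\<close> to \<open>2\<close>;
  their projections meet at the levels \<open>1 / 2\<close> and \<open>3 / 2\<close>.\<close>

definition left_strand :: "nat \<Rightarrow> (real^3) set" where
  "left_strand j = {p. 0 \<le> p $ 2 \<and> p $ 2 \<le> 2 \<and>
     p $ 1 = 2 * real j + 1 - \<bar>p $ 2 - 1\<bar> \<and> p $ 3 = twist j * (1 - \<bar>p $ 2 - 1\<bar>)}"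

definition right_strand :: "nat \<Rightarrow> (real^3) set" where
  "right_strand j = {p. 0 \<le> p $ 2 \<and> p $ 2 \<le> 2 \<and>
     p $ 1 = 2 * real j + \<bar>p $ 2 - 1\<bar> \<and> p $ 3 = 2 * twist j * max 0 (p $ 2 - 1)}"

text \<open>The segments from the right ends of a column to the left ends of the next column.\<close>

definition bridges :: "nat \<Rightarrow> (real^3) set" where
  "bridges j = {p. 2 * real j + 1 \<le> p $ 1 \<and> p $ 1 \<le> 2 * real j + 2 \<and>
     (p $ 2 = 0 \<and> p $ 3 = 0 \<or> p $ 2 = 2 \<and> p $ 3 = 2 * twist j * (2 * real j + 2 - p $ 1))}"

definition alternating :: "nat \<Rightarrow> int list" where
  "alternating m = map (\<lambda>j. if even j then 2 else - 2) [0..<m]"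

lemma left_strand_eq_segments:
  "left_strand j =
    closed_segment (vector [2 * real j, 0, 0]) (vector [2 * real j + 1, 1, twist j]) \<union>
    closed_segment (vector [2 * real j + 1, 1, twist j]) (vector [2 * real j, 2, 0])" (is "?L = ?R")
proof (rule set_eqI)
  fix p :: "real^3"
  have "\<bar>p $ 2 - 1\<bar> = 1 - p $ 2" if "p $ 2 \<le> 1" using that by simp
  moreover have "\<bar>p $ 2 - 1\<bar> = p $ 2 - 1" if "\<not> p $ 2 \<le> 1" using that by simp
  ultimately show "p \<in> ?L \<longleftrightarrow> p \<in> ?R"
    using twist_cases[of j]
    by (cases "p $ 2 \<le> 1"; elim disjE;
        simp add: left_strand_def closed_segment_over_axis[where i = 2] forall_3; argo)
qed

lemma right_strand_eq_segments:
  "right_strand j =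
    closed_segment (vector [2 * real j + 1, 0, 0]) (vector [2 * real j, 1, 0]) \<union>
    closed_segment (vector [2 * real j, 1, 0]) (vector [2 * real j + 1, 2, 2 * twist j])" (is "?L = ?R")
proof (rule set_eqI)
  fix p :: "real^3"
  have "\<bar>p $ 2 - 1\<bar> = 1 - p $ 2 \<and> max 0 (p $ 2 - 1) = 0" if "p $ 2 \<le> 1" using that by simp
  moreover have "\<bar>p $ 2 - 1\<bar> = p $ 2 - 1 \<and> max 0 (p $ 2 - 1) = p $ 2 - 1" if "\<not> p $ 2 \<le> 1"
    using that by simp
  ultimately show "p \<in> ?L \<longleftrightarrow> p \<in> ?R"
    using twist_cases[of j]
    by (cases "p $ 2 \<le> 1"; elim disjE;
        simp add: right_strand_def closed_segment_over_axis[where i = 2] forall_3; argo)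
qed

lemma column_eq_strands: "column j (if even j then 2 else - 2) = left_strand j \<union> right_strand j"
proof -
  define a :: int where "a = (if even j then 2 else - 2)"
  have a: "nat \<bar>a\<bar> = 2" "real_of_int (sgn a) = twist j" by (auto simp: a_def twist_def)
  have "column j a = left_strand j \<union> right_strand j"
    by (simp add: column_def a left_end_def right_end_def numeral_2_eq_2 lessThan_Suc
      left_strand_eq_segments right_strand_eq_segments Un_ac mult.commute)
  then show ?thesis by (simp add: a_def)
qed

text \<open>The number \<open>m\<close> of columns is even so that the twists alternate around the whole cycle, and at
  least \<open>4\<close> so that a ring has two different neighbours.\<close>

locale even_pretzel =
  fixes m :: nat
  assumes m_even: "even m" and m_ge: "4 \<le> m"
begin

text \<open>The outer paths above and below the columns, which join the last column to the first one.
  The first disjunct is the only sloping edge: it starts at the upper right end of the last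
  column, which has height \<open>-2\<close> because the last twist is negative.\<close>

definition frame :: "(real^3) set" where
  "frame = {p. p $ 1 = 2 * real m - 1 \<and> 2 \<le> p $ 2 \<and> p $ 2 \<le> 2 * real m + 1 \<and>
       p $ 3 = - 2 * (2 * real m + 1 - p $ 2) / (2 * real m - 1) \<or>
     p $ 2 = 2 * real m + 1 \<and> 0 \<le> p $ 1 \<and> p $ 1 \<le> 2 * real m - 1 \<and> p $ 3 = 0 \<or>
     p $ 1 = 0 \<and> 2 \<le> p $ 2 \<and> p $ 2 \<le> 2 * real m + 1 \<and> p $ 3 = 0 \<or>
     p $ 1 = 2 * real m - 1 \<and> - 1 \<le> p $ 2 \<and> p $ 2 \<le> 0 \<and> p $ 3 = 0 \<or>
     p $ 2 = - 1 \<and> 0 \<le> p $ 1 \<and> p $ 1 \<le> 2 * real m - 1 \<and> p $ 3 = 0 \<or>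
     p $ 1 = 0 \<and> - 1 \<le> p $ 2 \<and> p $ 2 \<le> 0 \<and> p $ 3 = 0}"

text \<open>The component between column \<open>i\<close> and its successor in the cyclic order.\<close>

definition ring :: "nat \<Rightarrow> (real^3) set" where
  "ring i = right_strand i \<union> left_strand (Suc i mod m) \<union> (if Suc i < m then bridges i else frame)"

definition chain :: "(real^3) set" where
  "chain = (\<Union>i<m. ring i)"

lemma m_real: "4 \<le> real m" using m_ge by simp

lemma twist_last: "twist (m - 1) = -1"
  using m_even m_ge by (auto simp: twist_def)

lemma bridges_eq_segments:
  "bridges j = closed_segment (vector [2 * real j + 1, 2, 2 * twist j]) (vector [2 * real j + 2, 2, 0]) \<union>
    closed_segment (vector [2 * real j + 1, 0, 0]) (vector [2 * real j + 2, 0, 0])"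
    (is "?L = ?R")
proof (rule set_eqI)
  fix p :: "real^3"
  show "p \<in> ?L \<longleftrightarrow> p \<in> ?R"
    using twist_cases[of j]
    by (elim disjE; simp add: bridges_def closed_segment_over_axis[where i = 1] forall_3; argo)
qed

lemma frame_eq_segments:
  "frame =
    closed_segment (vector [2 * real m - 1, 2, - 2]) (vector [2 * real m - 1, 2 * real m + 1, 0]) \<union>
    closed_segment (vector [2 * real m - 1, 2 * real m + 1, 0]) (vector [0, 2 * real m + 1, 0]) \<union>
    closed_segment (vector [0, 2 * real m + 1, 0]) (vector [0, 2, 0]) \<union>
    closed_segment (vector [2 * real m - 1, 0, 0]) (vector [2 * real m - 1, - 1, 0]) \<union>
    closed_segment (vector [2 * real m - 1, - 1, 0]) (vector [0, - 1, 0]) \<union>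
    closed_segment (vector [0, - 1, 0]) (vector [0, 0, 0])"
proof -
  have 1: "closed_segment (vector [2 * real m - 1, 2, - 2]) (vector [2 * real m - 1, 2 * real m + 1, 0]) =
    {p::real^3. p $ 1 = 2 * real m - 1 \<and> 2 \<le> p $ 2 \<and> p $ 2 \<le> 2 * real m + 1 \<and>
       p $ 3 = - 2 * (2 * real m + 1 - p $ 2) / (2 * real m - 1)}"
    using m_real by (auto simp: closed_segment_over_axis[where i = 2] forall_3) (simp_all add: field_simps)
  have 2: "closed_segment (vector [2 * real m - 1, 2 * real m + 1, 0]) (vector [0, 2 * real m + 1, 0]) =
    {p::real^3. p $ 2 = 2 * real m + 1 \<and> 0 \<le> p $ 1 \<and> p $ 1 \<le> 2 * real m - 1 \<and> p $ 3 = 0}"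
    using m_real by (subst closed_segment_commute) (auto simp: closed_segment_over_axis[where i = 1] forall_3)
  have 3: "closed_segment (vector [0, 2 * real m + 1, 0]) (vector [0, 2, 0]) =
    {p::real^3. p $ 1 = 0 \<and> 2 \<le> p $ 2 \<and> p $ 2 \<le> 2 * real m + 1 \<and> p $ 3 = 0}"
    using m_real by (subst closed_segment_commute) (auto simp: closed_segment_over_axis[where i = 2] forall_3)
  have 4: "closed_segment (vector [2 * real m - 1, 0, 0]) (vector [2 * real m - 1, - 1, 0]) =
    {p::real^3. p $ 1 = 2 * real m - 1 \<and> - 1 \<le> p $ 2 \<and> p $ 2 \<le> 0 \<and> p $ 3 = 0}"
    by (subst closed_segment_commute) (auto simp: closed_segment_over_axis[where i = 2] forall_3)
  have 5: "closed_segment (vector [2 * real m - 1, - 1, 0]) (vector [0, - 1, 0]) =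
    {p::real^3. p $ 2 = - 1 \<and> 0 \<le> p $ 1 \<and> p $ 1 \<le> 2 * real m - 1 \<and> p $ 3 = 0}"
    using m_real by (subst closed_segment_commute) (auto simp: closed_segment_over_axis[where i = 1] forall_3)
  have 6: "closed_segment (vector [0, - 1, 0]) (vector [0, 0, 0]) =
    {p::real^3. p $ 1 = 0 \<and> - 1 \<le> p $ 2 \<and> p $ 2 \<le> 0 \<and> p $ 3 = 0}"
    by (auto simp: closed_segment_over_axis[where i = 2] forall_3)
  show ?thesis unfolding 1 2 3 4 5 6 frame_def by (simp only: Collect_disj_eq Un_assoc)
qed

lemma chain_eq: "chain = (\<Union>j<m. left_strand j \<union> right_strand j) \<union> (\<Union>j<m - 1. bridges j) \<union> frame"
proof -
  have "(\<Union>i<m. left_strand (Suc i mod m)) = (\<Union>j<m. left_strand j)"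
  proof -
    have "(\<lambda>i. Suc i mod m) ` {..<m} = {..<m}"
    proof (intro equalityI subsetI)
      fix j assume "j \<in> {..<m}"
      then have "Suc ((j + (m - 1)) mod m) mod m = j" "(j + (m - 1)) mod m < m"
        using m_ge by (auto simp: mod_Suc_eq)
      then show "j \<in> (\<lambda>i. Suc i mod m) ` {..<m}" by (metis imageI lessThan_iff)
    qed (use m_ge in auto)
    then show ?thesis by (metis image_image)
  qed
  moreover have "(\<Union>i<m. if Suc i < m then bridges i else frame) = (\<Union>j<m - 1. bridges j) \<union> frame"
  proof -
    have "{..<m} = insert (m - 1) {..<m - 1}" using m_ge by auto
    moreover have "Suc j < m" if "j < m - 1" for j using that by simp
    moreover have "\<not> Suc (m - 1) < m" by simp
    ultimately show ?thesis by auto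
  qed
  ultimately show ?thesis
    unfolding chain_def ring_def by (simp only: UN_Un_distrib Un_ac)
qed

lemma pretzel_eq_chain: "pretzel (alternating m) = chain"
proof -
  define a where "a j = (if even j then 2 else - 2 :: int)" for j :: nat
  have len: "length (alternating m) = m" by (simp add: alternating_def)
  have nth: "alternating m ! j = a j" if "j < m" for j
    using that by (simp add: alternating_def a_def)
  have a: "nat \<bar>a j\<bar> = 2" "real_of_int (sgn (a j)) = twist j" for j
    by (auto simp: a_def twist_def)
  have Y: "1 + (\<Sum>j<m. real (nat \<bar>alternating m ! j\<bar>)) = 2 * real m + 1"
    by (simp add: nth a)
  have X: "2 * real (m - 1) + 1 = 2 * real m - 1" using m_ge by (simp add: of_nat_diff)
  have L: "left_end j 0 = vector [2 * real j, 0, 0]" "left_end j 2 = vector [2 * real j, 2, 0]" for j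
    by (simp_all add: left_end_def)
  have R: "right_end j (a j) 0 = vector [2 * real j + 1, 0, 0]"
    "right_end j (a j) 2 = vector [2 * real j + 1, 2, 2 * twist j]" for j
    by (simp_all add: right_end_def a mult.commute)
  have cols: "(\<Union>j<m. column j (alternating m ! j)) = (\<Union>j<m. left_strand j \<union> right_strand j)"
    using nth column_eq_strands by (intro SUP_cong) (auto simp: a_def)
  have br: "(\<Union>j<m - 1.
       closed_segment (right_end j (alternating m ! j) (nat \<bar>alternating m ! j\<bar>))
         (left_end (Suc j) (nat \<bar>alternating m ! Suc j\<bar>)) \<union>
       closed_segment (right_end j (alternating m ! j) 0) (left_end (Suc j) 0)) = (\<Union>j<m - 1. bridges j)"
    by (intro SUP_cong refl) (simp add: nth a L R bridges_eq_segments add.commute)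
  have fr: "m - 1 < m" "0 < m" using m_ge by auto
  show ?thesis
    unfolding pretzel_def Let_def len Y cols br chain_eq
    unfolding frame_eq_segments Un_assoc
    using fr by (simp only: nth a L R X twist_last of_nat_0 mult_zero_right mult_minus1_right)
qed

end

section \<open>Points with the same projection\<close>

text \<open>The pieces are compared pairwise. Apart from the two strands of one column, points of two pieces
  with the same projection coincide, and they occur only on pieces of the same ring.\<close>

lemma proj_eq_iff: "proj p = proj q \<longleftrightarrow> p $ 1 = q $ 1 \<and> p $ 2 = q $ 2"
  by (simp add: proj_def)

lemma proj_left_left:
  assumes "p \<in> left_strand j" "q \<in> left_strand k" "proj p = proj q"
  shows "j = k \<and> p = q"
proof -
  have "j = k" using assms by (auto simp: left_strand_def proj_eq_iff)
  then show ?thesis using assms by (auto simp: left_strand_def proj_eq_iff vec3_eq_iff)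
qed

lemma proj_right_right:
  assumes "p \<in> right_strand j" "q \<in> right_strand k" "proj p = proj q"
  shows "j = k \<and> p = q"
proof -
  have "j = k" using assms by (auto simp: right_strand_def proj_eq_iff)
  then show ?thesis using assms by (auto simp: right_strand_def proj_eq_iff vec3_eq_iff)
qed

lemma proj_left_right:
  assumes "p \<in> left_strand j" "q \<in> right_strand k" "proj p = proj q"
  shows "j = k \<and> \<bar>p $ 2 - 1\<bar> = 1 / 2"
proof -
  have x: "2 * real j + 1 - \<bar>p $ 2 - 1\<bar> = 2 * real k + \<bar>p $ 2 - 1\<bar>"
    using assms by (auto simp: left_strand_def right_strand_def proj_eq_iff)
  have "\<bar>p $ 2 - 1\<bar> \<le> 1" using assms by (auto simp: left_strand_def)
  then have "real j < real k + 1" "real k < real j + 1" using x by linarith+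
  then have "j = k" by linarith
  then show ?thesis using x by simp
qed

lemma left_right_disjoint:
  assumes "p \<in> left_strand j"
  shows "p \<notin> right_strand k"
proof
  assume r: "p \<in> right_strand k"
  have "j = k" "\<bar>p $ 2 - 1\<bar> = 1 / 2" using proj_left_right[OF assms r refl] by auto
  then show False
    using assms r twist_cases[of j]
    by (auto simp: left_strand_def right_strand_def max_def abs_if split: if_splits)
qed

lemma proj_left_bridges:
  assumes "p \<in> left_strand j" "q \<in> bridges k" "proj p = proj q"
  shows "j = Suc k \<and> p = q"
proof -
  have y: "p $ 2 = 0 \<or> p $ 2 = 2" and x: "p $ 1 = 2 * real j"
    using assms by (auto simp: left_strand_def bridges_def proj_eq_iff)
  have "2 * real k + 1 \<le> 2 * real j" "2 * real j \<le> 2 * real k + 2"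
    using assms x by (auto simp: bridges_def proj_eq_iff)
  then have "j = Suc k" by linarith
  then show ?thesis using assms x y by (auto simp: left_strand_def bridges_def proj_eq_iff vec3_eq_iff)
qed

lemma proj_right_bridges:
  assumes "p \<in> right_strand j" "q \<in> bridges k" "proj p = proj q"
  shows "j = k \<and> p = q"
proof -
  have y: "p $ 2 = 0 \<or> p $ 2 = 2" and x: "p $ 1 = 2 * real j + 1"
    using assms by (auto simp: right_strand_def bridges_def proj_eq_iff)
  have "2 * real k + 1 \<le> 2 * real j + 1" "2 * real j + 1 \<le> 2 * real k + 2"
    using assms x by (auto simp: bridges_def proj_eq_iff)
  then have "j = k" by linarith
  then show ?thesis using assms x y by (auto simp: right_strand_def bridges_def proj_eq_iff vec3_eq_iff)
qed

lemma proj_bridges_bridges: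
  assumes "p \<in> bridges j" "q \<in> bridges k" "proj p = proj q"
  shows "j = k \<and> p = q"
proof -
  have "2 * real j + 1 \<le> 2 * real k + 2" "2 * real k + 1 \<le> 2 * real j + 2"
    using assms by (auto simp: bridges_def proj_eq_iff)
  then have "j = k" by linarith
  then show ?thesis using assms by (auto simp: bridges_def proj_eq_iff vec3_eq_iff)
qed

context even_pretzel
begin

lemma proj_left_frame:
  assumes "p \<in> left_strand j" "q \<in> frame" "proj p = proj q" "j < m"
  shows "j = 0 \<and> p = q"
proof -
  have "\<bar>q $ 2 - 1\<bar> \<ge> 1" using assms m_real by (auto simp: frame_def)
  then have y: "q $ 2 = 0 \<or> q $ 2 = 2" and x: "p $ 1 = 2 * real j"
    using assms by (auto simp: left_strand_def proj_eq_iff)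
  have "q $ 1 = 0 \<or> q $ 1 = 2 * real m - 1"
    using y assms m_real by (auto simp: frame_def)
  then have "j = 0" using x assms by (auto simp: proj_eq_iff)
  then show ?thesis using assms x y m_real by (auto simp: left_strand_def frame_def proj_eq_iff vec3_eq_iff)
qed

lemma proj_right_frame:
  assumes "p \<in> right_strand j" "q \<in> frame" "proj p = proj q" "j < m"
  shows "j = m - 1 \<and> p = q"
proof -
  have "\<bar>q $ 2 - 1\<bar> \<ge> 1" using assms m_real by (auto simp: frame_def)
  then have y: "q $ 2 = 0 \<or> q $ 2 = 2" and x: "p $ 1 = 2 * real j + 1"
    using assms by (auto simp: right_strand_def proj_eq_iff)
  have "q $ 1 = 0 \<or> q $ 1 = 2 * real m - 1"
    using y assms m_real by (auto simp: frame_def)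
  then have j: "j = m - 1" using x assms by (auto simp: proj_eq_iff)
  have "p $ 3 = q $ 3"
    using y
  proof
    assume y2: "q $ 2 = 2"
    have "- 2 * (2 * real m + 1 - 2) / (2 * real m - 1) = - 2"
      using m_real by (simp add: field_simps)
    then have "q $ 3 = - 2"
      using y2 assms(2) \<open>q $ 1 = 0 \<or> q $ 1 = 2 * real m - 1\<close> x assms(3) m_real
      by (auto simp: frame_def proj_eq_iff)
    moreover have "p $ 3 = - 2"
      using y2 assms twist_last by (simp add: right_strand_def proj_eq_iff j)
    ultimately show ?thesis by simp
  next
    assume "q $ 2 = 0"
    then show ?thesis
      using assms x m_real by (auto simp: right_strand_def frame_def proj_eq_iff j)
  qed
  then show ?thesis using j assms by (simp add: proj_eq_iff vec3_eq_iff)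
qed

lemma proj_bridges_frame:
  assumes "p \<in> bridges j" "q \<in> frame" "proj p = proj q" "Suc j < m"
  shows False
proof -
  have "p $ 1 \<le> 2 * real j + 2" "real j + 2 \<le> real m" "1 \<le> p $ 1" "p $ 2 = 0 \<or> p $ 2 = 2"
    using assms by (auto simp: bridges_def)
  then show False using assms(2,3) m_real by (auto simp: frame_def proj_eq_iff)
qed

lemma proj_frame_frame:
  assumes "p \<in> frame" "q \<in> frame" "proj p = proj q"
  shows "p = q"
  using assms m_real unfolding frame_def proj_eq_iff vec3_eq_iff by auto

lemma chain_cases:
  assumes "p \<in> chain"
  obtains j where "j < m" "p \<in> left_strand j" | j where "j < m" "p \<in> right_strand j"
    | j where "Suc j < m" "p \<in> bridges j" | "p \<in> frame"
  using assms unfolding chain_eq by (auto simp: less_diff_conv)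

text \<open>The projection is injective except at the crossings of the two strands of a column, where
  \<open>1 - \<bar>y - 1\<bar> = \<bar>y - 1\<bar>\<close> for the common level \<open>y\<close>.\<close>

lemma same_projection:
  assumes "p \<in> chain" "q \<in> chain" "proj p = proj q" "p \<noteq> q"
  shows "\<exists>j<m. \<bar>p $ 2 - 1\<bar> = 1 / 2 \<and>
    (p \<in> left_strand j \<and> q \<in> right_strand j \<or> p \<in> right_strand j \<and> q \<in> left_strand j)"
proof -
  have y: "p $ 2 = q $ 2" and sym: "proj q = proj p" using assms by (auto simp: proj_eq_iff)
  note pq = assms(3,4)
  show ?thesis
    using \<open>p \<in> chain\<close>
  proof (cases rule: chain_cases)
    case (1 j)
    show ?thesis using \<open>q \<in> chain\<close>
      by (cases rule: chain_cases) (use 1 pq proj_left_left proj_left_right proj_left_bridges proj_left_frame in blast)+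
  next
    case (2 j)
    show ?thesis using \<open>q \<in> chain\<close>
      by (cases rule: chain_cases) (use 2 pq sym y proj_right_right proj_left_right proj_right_bridges proj_right_frame in metis)+
  next
    case (3 j)
    show ?thesis using \<open>q \<in> chain\<close>
      by (cases rule: chain_cases) (use 3 pq sym proj_left_bridges proj_right_bridges proj_bridges_bridges proj_bridges_frame in metis)+
  next
    case 4
    show ?thesis using \<open>q \<in> chain\<close>
      by (cases rule: chain_cases) (use 4 pq sym proj_left_frame proj_right_frame proj_bridges_frame proj_frame_frame in metis)+
  qed
qed

lemma ring_unique:
  assumes "p \<in> ring i" "p \<in> ring k" "i < m" "k < m"
  shows "i = k"
proof -
  have mod: "Suc i mod m < m" "Suc k mod m < m" using m_ge by auto
  have mod0: "a = m - 1" if "Suc a mod m = 0" "a < m" for a using that by (auto simp: mod_Suc split: if_splits)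
  have last: "a = m - 1" if "\<not> Suc a < m" "a < m" for a using that by simp
  have L: "i' = k'" if "p \<in> left_strand (Suc i' mod m)" "p \<in> ring k'" "i' < m" "k' < m" for i' k'
  proof -
    have "p \<in> left_strand (Suc k' mod m) \<or> Suc k' < m \<and> p \<in> bridges k' \<or> \<not> Suc k' < m \<and> p \<in> frame"
      using that left_right_disjoint unfolding ring_def by (auto split: if_splits)
    then show ?thesis
    proof (elim disjE conjE)
      assume "p \<in> left_strand (Suc k' mod m)"
      then have "Suc i' mod m = Suc k' mod m" using proj_left_left that by blast
      then show ?thesis using that(3,4) by (auto simp: mod_Suc split: if_splits)
    next
      assume "Suc k' < m" "p \<in> bridges k'"
      then have "Suc i' mod m = Suc k'" using proj_left_bridges that by blast
      then show ?thesis using that(3,4) by (auto simp: mod_Suc split: if_splits)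
    next
      assume "\<not> Suc k' < m" "p \<in> frame"
      then have "Suc i' mod m = 0" using proj_left_frame[OF that(1) _ refl] m_ge by auto
      then show ?thesis using mod0 last that \<open>\<not> Suc k' < m\<close> by metis
    qed
  qed
  have R: "i' = k'" if "p \<in> right_strand i'" "p \<in> ring k'" "i' < m" "k' < m" for i' k'
  proof -
    have "p \<in> right_strand k' \<or> Suc k' < m \<and> p \<in> bridges k' \<or> \<not> Suc k' < m \<and> p \<in> frame"
      using that left_right_disjoint unfolding ring_def by (auto split: if_splits)
    then show ?thesis
      using proj_right_right proj_right_bridges proj_right_frame last that by metis
  qed
  have "p \<in> left_strand (Suc i mod m) \<or> p \<in> right_strand i \<or> Suc i < m \<and> p \<in> bridges i \<or> \<not> Suc i < m \<and> p \<in> frame"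
    using assms unfolding ring_def by (auto split: if_splits)
  moreover have "p \<in> left_strand (Suc k mod m) \<or> p \<in> right_strand k \<or> Suc k < m \<and> p \<in> bridges k \<or> \<not> Suc k < m \<and> p \<in> frame"
    using assms unfolding ring_def by (auto split: if_splits)
  ultimately show ?thesis
    using L[OF _ assms(2,3,4)] L[OF _ assms(1,4,3)] R[OF _ assms(2,3,4)] R[OF _ assms(1,4,3)]
      proj_bridges_bridges proj_bridges_frame last assms(3,4) by metis
qed

end

section \<open>The rings are simple polygons\<close>

lemma simple_polygonI:
  assumes "3 \<le> length vs" "distinct vs"
    and "\<forall>j<length vs. \<forall>i<j. \<forall>p. p \<in> polygon_edge vs i \<longrightarrow> p \<in> polygon_edge vs j \<longrightarrow>
      p \<in> {vs ! i, vs ! (Suc i mod length vs)} \<inter> {vs ! j, vs ! (Suc j mod length vs)}"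
  shows "simple_polygon vs"
  unfolding simple_polygon_def
proof (intro conjI assms(1,2) allI impI)
  fix i j assume "i < length vs" "j < length vs" "i \<noteq> j"
  then show "polygon_edge vs i \<inter> polygon_edge vs j
      \<subseteq> {vs ! i, vs ! (Suc i mod length vs)} \<inter> {vs ! j, vs ! (Suc j mod length vs)}"
    using assms(3) by (cases "i < j") (simp_all add: subset_iff, (metis linorder_neqE_nat)+)
qed

definition hexagon :: "nat \<Rightarrow> (real^3) list" where
  "hexagon i =
    [vector [2 * real i + 1, 0, 0], vector [2 * real i, 1, 0], vector [2 * real i + 1, 2, 2 * twist i],
     vector [2 * real i + 2, 2, 0], vector [2 * real i + 3, 1, - twist i], vector [2 * real i + 2, 0, 0]]"

text \<open>Unrolls a quantifier over the edges of a polygon into finitely many instances.\<close>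

lemma all_less_numeral: "(\<forall>i<numeral k. P i) \<longleftrightarrow> P (pred_numeral k) \<and> (\<forall>i<pred_numeral k. P i)"
  by (simp only: numeral_eq_Suc All_less_Suc)

lemma hexagon_edges:
  defines "c \<equiv> \<lambda>i. 2 * real i"
  shows
  "p \<in> polygon_edge (hexagon i) 0 \<longleftrightarrow> 0 \<le> p $ 2 \<and> p $ 2 \<le> 1 \<and> p $ 1 = c i + 1 - p $ 2 \<and> p $ 3 = 0"
  "p \<in> polygon_edge (hexagon i) (Suc 0) \<longleftrightarrow> 1 \<le> p $ 2 \<and> p $ 2 \<le> 2 \<and> p $ 1 = c i - 1 + p $ 2 \<and> p $ 3 = 2 * twist i * (p $ 2 - 1)"
  "p \<in> polygon_edge (hexagon i) 2 \<longleftrightarrow> c i + 1 \<le> p $ 1 \<and> p $ 1 \<le> c i + 2 \<and> p $ 2 = 2 \<and> p $ 3 = 2 * twist i * (c i + 2 - p $ 1)"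
  "p \<in> polygon_edge (hexagon i) 3 \<longleftrightarrow> 1 \<le> p $ 2 \<and> p $ 2 \<le> 2 \<and> p $ 1 = c i + 4 - p $ 2 \<and> p $ 3 = - twist i * (2 - p $ 2)"
  "p \<in> polygon_edge (hexagon i) 4 \<longleftrightarrow> 0 \<le> p $ 2 \<and> p $ 2 \<le> 1 \<and> p $ 1 = c i + 2 + p $ 2 \<and> p $ 3 = - twist i * p $ 2"
  "p \<in> polygon_edge (hexagon i) 5 \<longleftrightarrow> c i + 1 \<le> p $ 1 \<and> p $ 1 \<le> c i + 2 \<and> p $ 2 = 0 \<and> p $ 3 = 0"
proof -
  note edge = polygon_edge_def hexagon_def c_def
  show "p \<in> polygon_edge (hexagon i) 0 \<longleftrightarrow> 0 \<le> p $ 2 \<and> p $ 2 \<le> 1 \<and> p $ 1 = c i + 1 - p $ 2 \<and> p $ 3 = 0"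
    by (simp add: edge closed_segment_over_axis[where i = 2] forall_3) argo
  show "p \<in> polygon_edge (hexagon i) (Suc 0) \<longleftrightarrow> 1 \<le> p $ 2 \<and> p $ 2 \<le> 2 \<and>
      p $ 1 = c i - 1 + p $ 2 \<and> p $ 3 = 2 * twist i * (p $ 2 - 1)"
    by (simp add: edge closed_segment_over_axis[where i = 2] forall_3) argo
  show "p \<in> polygon_edge (hexagon i) 2 \<longleftrightarrow> c i + 1 \<le> p $ 1 \<and> p $ 1 \<le> c i + 2 \<and> p $ 2 = 2 \<and>
      p $ 3 = 2 * twist i * (c i + 2 - p $ 1)"
    using twist_cases[of i]
    by (elim disjE; simp add: edge closed_segment_over_axis[where i = 1] forall_3; argo)
  show "p \<in> polygon_edge (hexagon i) 3 \<longleftrightarrow> 1 \<le> p $ 2 \<and> p $ 2 \<le> 2 \<and> p $ 1 = c i + 4 - p $ 2 \<and>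
      p $ 3 = - twist i * (2 - p $ 2)"
    using twist_cases[of i]
    by (elim disjE; simp add: edge closed_segment_commute[of "vector [2 * real i + 2, 2, 0]"]
        closed_segment_over_axis[where i = 2] forall_3; argo)
  show "p \<in> polygon_edge (hexagon i) 4 \<longleftrightarrow> 0 \<le> p $ 2 \<and> p $ 2 \<le> 1 \<and> p $ 1 = c i + 2 + p $ 2 \<and>
      p $ 3 = - twist i * p $ 2"
    using twist_cases[of i]
    by (elim disjE; simp add: edge closed_segment_commute[of "vector [2 * real i + 3, 1, _]"]
        closed_segment_over_axis[where i = 2] forall_3; argo)
  show "p \<in> polygon_edge (hexagon i) 5 \<longleftrightarrow> c i + 1 \<le> p $ 1 \<and> p $ 1 \<le> c i + 2 \<and> p $ 2 = 0 \<and> p $ 3 = 0"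
    by (simp add: edge closed_segment_commute[of "vector [2 * real i + 2, 0, 0]"]
        closed_segment_over_axis[where i = 1] forall_3)
qed

lemma simple_hexagon: "simple_polygon (hexagon i)"
proof (rule simple_polygonI)
  have l: "length (hexagon i) = 6" by (simp add: hexagon_def)
  show "3 \<le> length (hexagon i)" by (simp add: l)
  show "distinct (hexagon i)" by (auto simp: hexagon_def vec3_eq_iff)
  show "\<forall>k<length (hexagon i). \<forall>j<k. \<forall>p. p \<in> polygon_edge (hexagon i) j \<longrightarrow> p \<in> polygon_edge (hexagon i) k \<longrightarrow>
      p \<in> {hexagon i ! j, hexagon i ! (Suc j mod length (hexagon i))} \<inter> {hexagon i ! k, hexagon i ! (Suc k mod length (hexagon i))}"
    unfolding l
    by (simp add: all_less_numeral hexagon_edges, intro conjI) (auto simp: hexagon_def vec3_eq_iff)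
qed

context even_pretzel
begin

lemma closed_hexagon:
  assumes "Suc i < m"
  shows "closed_polygon (hexagon i) = ring i"
proof -
  have l: "length (hexagon i) = 6" by (simp add: hexagon_def)
  have "{..<6} = {0, 1, 2, 3, 4, 5::nat}" by auto
  then have "closed_polygon (hexagon i) = (\<Union>k\<in>{0, 1, 2, 3, 4, 5}. polygon_edge (hexagon i) k)"
    by (simp only: closed_polygon_def l)
  also have "\<dots> = ring i"
    using assms
    by (simp add: ring_def polygon_edge_def hexagon_def twist_Suc left_strand_eq_segments
        right_strand_eq_segments bridges_eq_segments closed_segment_commute Un_ac add.commute)
  finally show ?thesis .
qed

text \<open>The last ring: the right strand of the last column, the upper path, the left strand of the first
  column and the lower path.\<close>

definition decagon :: "(real^3) list" where
  "decagon =
    [vector [2 * real m - 1, 0, 0], vector [2 * real m - 2, 1, 0], vector [2 * real m - 1, 2, - 2],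
     vector [2 * real m - 1, 2 * real m + 1, 0], vector [0, 2 * real m + 1, 0], vector [0, 2, 0],
     vector [1, 1, 1], vector [0, 0, 0], vector [0, - 1, 0], vector [2 * real m - 1, - 1, 0]]"

lemma closed_decagon: "closed_polygon decagon = ring (m - 1)"
proof -
  have l: "length decagon = 10" by (simp add: decagon_def)
  have "{..<10} = {0, 1, 2, 3, 4, 5, 6, 7, 8, 9::nat}" by auto
  then have dec: "closed_polygon decagon = (\<Union>k\<in>{0, 1, 2, 3, 4, 5, 6, 7, 8, 9}. polygon_edge decagon k)"
    by (simp only: closed_polygon_def l)
  have "real (m - 1) = real m - 1" using m_ge by (simp add: of_nat_diff)
  then have *: "2 * real (m - 1) + 1 = 2 * real m - 1" "2 * real (m - 1) = 2 * real m - 2" by auto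
  have right: "right_strand (m - 1) =
      closed_segment (vector [2 * real m - 1, 0, 0]) (vector [2 * real m - 2, 1, 0]) \<union>
      closed_segment (vector [2 * real m - 2, 1, 0]) (vector [2 * real m - 1, 2, - 2])"
    unfolding right_strand_eq_segments twist_last * by simp
  have left: "left_strand 0 = closed_segment (vector [0, 0, 0]) (vector [1, 1, 1]) \<union>
      closed_segment (vector [1, 1, 1]) (vector [0, 2, 0])"
    by (simp add: left_strand_eq_segments twist_def)
  have "ring (m - 1) = right_strand (m - 1) \<union> left_strand 0 \<union> frame"
    using m_ge by (simp add: ring_def)
  then show ?thesis
    unfolding right left frame_eq_segments dec
    by (simp add: polygon_edge_def decagon_def closed_segment_commute Un_ac)
qed

lemma decagon_edges:
  shows
  "p \<in> polygon_edge decagon 0 \<longleftrightarrow> 0 \<le> p $ 2 \<and> p $ 2 \<le> 1 \<and> p $ 1 = 2 * real m - 1 - p $ 2 \<and> p $ 3 = 0"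
  "p \<in> polygon_edge decagon (Suc 0) \<longleftrightarrow> 1 \<le> p $ 2 \<and> p $ 2 \<le> 2 \<and> p $ 1 = 2 * real m - 3 + p $ 2 \<and> p $ 3 = 2 - 2 * p $ 2"
  "p \<in> polygon_edge decagon 2 \<longleftrightarrow> 2 \<le> p $ 2 \<and> p $ 2 \<le> 2 * real m + 1 \<and> p $ 1 = 2 * real m - 1 \<and>
     p $ 3 = - 2 * (2 * real m + 1 - p $ 2) / (2 * real m - 1)"
  "p \<in> polygon_edge decagon 3 \<longleftrightarrow> 0 \<le> p $ 1 \<and> p $ 1 \<le> 2 * real m - 1 \<and> p $ 2 = 2 * real m + 1 \<and> p $ 3 = 0"
  "p \<in> polygon_edge decagon 4 \<longleftrightarrow> 2 \<le> p $ 2 \<and> p $ 2 \<le> 2 * real m + 1 \<and> p $ 1 = 0 \<and> p $ 3 = 0"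
  "p \<in> polygon_edge decagon 5 \<longleftrightarrow> 1 \<le> p $ 2 \<and> p $ 2 \<le> 2 \<and> p $ 1 = 2 - p $ 2 \<and> p $ 3 = 2 - p $ 2"
  "p \<in> polygon_edge decagon 6 \<longleftrightarrow> 0 \<le> p $ 2 \<and> p $ 2 \<le> 1 \<and> p $ 1 = p $ 2 \<and> p $ 3 = p $ 2"
  "p \<in> polygon_edge decagon 7 \<longleftrightarrow> - 1 \<le> p $ 2 \<and> p $ 2 \<le> 0 \<and> p $ 1 = 0 \<and> p $ 3 = 0"
  "p \<in> polygon_edge decagon 8 \<longleftrightarrow> 0 \<le> p $ 1 \<and> p $ 1 \<le> 2 * real m - 1 \<and> p $ 2 = - 1 \<and> p $ 3 = 0"
  "p \<in> polygon_edge decagon 9 \<longleftrightarrow> - 1 \<le> p $ 2 \<and> p $ 2 \<le> 0 \<and> p $ 1 = 2 * real m - 1 \<and> p $ 3 = 0"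
proof -
  note edge = polygon_edge_def decagon_def forall_3
  show "p \<in> polygon_edge decagon 0 \<longleftrightarrow> 0 \<le> p $ 2 \<and> p $ 2 \<le> 1 \<and> p $ 1 = 2 * real m - 1 - p $ 2 \<and> p $ 3 = 0"
    using m_real
    by (simp add: edge closed_segment_over_axis[where i = 2]) argo
  show "p \<in> polygon_edge decagon (Suc 0) \<longleftrightarrow> 1 \<le> p $ 2 \<and> p $ 2 \<le> 2 \<and> p $ 1 = 2 * real m - 3 + p $ 2 \<and> p $ 3 = 2 - 2 * p $ 2"
    using m_real
    by (simp add: edge closed_segment_over_axis[where i = 2]) argo
  show "p \<in> polygon_edge decagon 2 \<longleftrightarrow> 2 \<le> p $ 2 \<and> p $ 2 \<le> 2 * real m + 1 \<and> p $ 1 = 2 * real m - 1 \<and>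
     p $ 3 = - 2 * (2 * real m + 1 - p $ 2) / (2 * real m - 1)"
    using m_real
    by (simp add: edge closed_segment_over_axis[where i = 2]) (auto simp: field_simps)
  show "p \<in> polygon_edge decagon 3 \<longleftrightarrow> 0 \<le> p $ 1 \<and> p $ 1 \<le> 2 * real m - 1 \<and> p $ 2 = 2 * real m + 1 \<and> p $ 3 = 0"
    using m_real
    by (auto simp: edge closed_segment_commute[of "vector [2 * real m - 1, 2 * real m + 1, 0]"] closed_segment_over_axis[where i = 1])
  show "p \<in> polygon_edge decagon 4 \<longleftrightarrow> 2 \<le> p $ 2 \<and> p $ 2 \<le> 2 * real m + 1 \<and> p $ 1 = 0 \<and> p $ 3 = 0"
    using m_real
    by (auto simp: edge closed_segment_commute[of "vector [0, 2 * real m + 1, 0]"] closed_segment_over_axis[where i = 2])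
  show "p \<in> polygon_edge decagon 5 \<longleftrightarrow> 1 \<le> p $ 2 \<and> p $ 2 \<le> 2 \<and> p $ 1 = 2 - p $ 2 \<and> p $ 3 = 2 - p $ 2"
    using m_real
    by (auto simp: edge closed_segment_commute[of "vector [0, 2, 0]"] closed_segment_over_axis[where i = 2]) 
  show "p \<in> polygon_edge decagon 6 \<longleftrightarrow> 0 \<le> p $ 2 \<and> p $ 2 \<le> 1 \<and> p $ 1 = p $ 2 \<and> p $ 3 = p $ 2"
    using m_real
    by (auto simp: edge closed_segment_commute[of "vector [1, 1, 1]"] closed_segment_over_axis[where i = 2]) 
  show "p \<in> polygon_edge decagon 7 \<longleftrightarrow> - 1 \<le> p $ 2 \<and> p $ 2 \<le> 0 \<and> p $ 1 = 0 \<and> p $ 3 = 0"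
    using m_real
    by (auto simp: edge closed_segment_commute[of "vector [0, 0, 0]"] closed_segment_over_axis[where i = 2])
  show "p \<in> polygon_edge decagon 8 \<longleftrightarrow> 0 \<le> p $ 1 \<and> p $ 1 \<le> 2 * real m - 1 \<and> p $ 2 = - 1 \<and> p $ 3 = 0"
    using m_real
    by (auto simp: edge closed_segment_over_axis[where i = 1]) 
  show "p \<in> polygon_edge decagon 9 \<longleftrightarrow> - 1 \<le> p $ 2 \<and> p $ 2 \<le> 0 \<and> p $ 1 = 2 * real m - 1 \<and> p $ 3 = 0"
    using m_real
    by (auto simp: edge closed_segment_over_axis[where i = 2]) 
qed

lemma simple_decagon: "simple_polygon decagon"
proof (rule simple_polygonI)
  have l: "length decagon = 10" by (simp add: decagon_def)
  show "3 \<le> length decagon" by (simp add: l)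
  show "distinct decagon" using m_real by (auto simp: decagon_def vec3_eq_iff)
  show "\<forall>k<length decagon. \<forall>j<k. \<forall>p. p \<in> polygon_edge decagon j \<longrightarrow> p \<in> polygon_edge decagon k \<longrightarrow>
      p \<in> {decagon ! j, decagon ! (Suc j mod length decagon)} \<inter> {decagon ! k, decagon ! (Suc k mod length decagon)}"
    unfolding l
    using m_real
    by (simp add: all_less_numeral decagon_edges, intro conjI) (auto simp: decagon_def vec3_eq_iff)
qed

section \<open>The standard diagram and its crossings\<close>

definition vertices :: "nat \<Rightarrow> (real^3) list" where
  "vertices i = (if Suc i < m then hexagon i else decagon)"

lemma closed_vertices:
  assumes "i < m"
  shows "closed_polygon (vertices i) = ring i"
proof (cases "Suc i < m")
  case True
  then show ?thesis by (simp add: vertices_def closed_hexagon)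
next
  case False
  then have "i = m - 1" using assms by simp
  then show ?thesis using False closed_decagon by (simp add: vertices_def)
qed

lemma polygonal_link_chain: "polygonal_link (vertices ` {..<m})"
  unfolding polygonal_link_def
proof (intro conjI ballI pairwiseI)
  show "vertices ` {..<m} \<noteq> {}" using m_ge by (simp add: lessThan_empty_iff)
  show "simple_polygon vs" if "vs \<in> vertices ` {..<m}" for vs
    using that by (auto simp: vertices_def simple_hexagon simple_decagon)
  fix vs ws assume "vs \<in> vertices ` {..<m}" "ws \<in> vertices ` {..<m}" "vs \<noteq> ws"
  then obtain i k where "i < m" "k < m" "vs = vertices i" "ws = vertices k" "i \<noteq> k" by auto
  then show "disjnt (closed_polygon vs) (closed_polygon ws)"
    using ring_unique by (auto simp: closed_vertices disjnt_iff)
qed simp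

lemma carrier_chain: "carrier_set (vertices ` {..<m}) = chain"
  by (simp add: carrier_set_def chain_def closed_vertices)

lemma left_subset_ring:
  assumes "j < m"
  shows "\<exists>i<m. left_strand j \<subseteq> ring i \<and> odd (i + j) \<and> Suc i mod m = j"
proof (cases j)
  case 0
  then show ?thesis using m_even m_ge by (intro exI[of _ "m - 1"]) (auto simp: ring_def)
next
  case (Suc i)
  then show ?thesis using assms by (intro exI[of _ i]) (auto simp: ring_def)
qed

lemma right_subset_ring: "right_strand j \<subseteq> ring j"
  by (auto simp: ring_def)

lemma ring_subset_chain: "i < m \<Longrightarrow> ring i \<subseteq> chain"
  by (auto simp: chain_def)

lemma strands_subset_chain: "j < m \<Longrightarrow> left_strand j \<subseteq> chain" "j < m \<Longrightarrow> right_strand j \<subseteq> chain"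
  using left_subset_ring right_subset_ring ring_subset_chain by (meson order_trans)+

text \<open>At the level \<open>1 / 2\<close> the left strand has height \<open>twist j / 2\<close> and the right strand has height \<open>0\<close>;
  at the level \<open>3 / 2\<close> the heights are \<open>twist j / 2\<close> and \<open>twist j\<close>. So the left strand is the over strand
  at the lower crossing if the twist is positive, and at the upper crossing if it is negative.\<close>

lemma crossing_cases:
  assumes "(p, u) \<in> crossings chain"
  obtains j where "j < m" "p $ 1 = 2 * real j + 1 / 2" "p $ 2 = 1 / 2 \<or> p $ 2 = 3 / 2"
    "if even j = (p $ 2 = 1 / 2) then p \<in> left_strand j \<and> u \<in> right_strand j
      else p \<in> right_strand j \<and> u \<in> left_strand j"
proof -
  have pu: "p \<in> chain" "u \<in> chain" "proj p = proj u" "u $ 3 < p $ 3" "p \<noteq> u"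
    using assms by (auto simp: crossings_def)
  then obtain j where j: "j < m" "\<bar>p $ 2 - 1\<bar> = 1 / 2"
    "p \<in> left_strand j \<and> u \<in> right_strand j \<or> p \<in> right_strand j \<and> u \<in> left_strand j"
    using same_projection by blast
  have y: "p $ 2 = 1 / 2 \<or> p $ 2 = 3 / 2" using j(2) by (auto simp: abs_if split: if_splits)
  have u2: "u $ 2 = p $ 2" using pu(3) by (simp add: proj_eq_iff)
  have "p $ 1 = 2 * real j + 1 / 2"
    using j(2,3) by (auto simp: left_strand_def right_strand_def)
  moreover have "if even j = (p $ 2 = 1 / 2) then p \<in> left_strand j \<and> u \<in> right_strand j
      else p \<in> right_strand j \<and> u \<in> left_strand j"
    using j(3) y pu(4) u2 by (cases "even j") (auto simp: left_strand_def right_strand_def twist_def)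
  ultimately show ?thesis using that j(1) y by blast
qed

text \<open>A crossing is determined by its projection, and there are two possible levels in each
  column.\<close>

lemma crossings_bound: "finite (crossings chain) \<and> card (crossings chain) \<le> 2 * m"
proof -
  define f where "f = (\<lambda>(p :: real^3, u :: real^3). proj p)"
  have inj: "inj_on f (crossings chain)"
  proof (rule inj_onI)
    fix c d assume cd: "c \<in> crossings chain" "d \<in> crossings chain" "f c = f d"
    obtain p u p' u' where pair: "c = (p, u)" "d = (p', u')" by (metis surj_pair)
    note c = cd[unfolded pair]
    then have eq: "proj p = proj p'" "proj u = proj u'" by (auto simp: f_def crossings_def)
    from c(1) obtain j where j: "p $ 1 = 2 * real j + 1 / 2"
      "if even j = (p $ 2 = 1 / 2) then p \<in> left_strand j \<and> u \<in> right_strand j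
      else p \<in> right_strand j \<and> u \<in> left_strand j" by (rule crossing_cases)
    from c(2) obtain j' where j': "p' $ 1 = 2 * real j' + 1 / 2"
      "if even j' = (p' $ 2 = 1 / 2) then p' \<in> left_strand j' \<and> u' \<in> right_strand j'
      else p' \<in> right_strand j' \<and> u' \<in> left_strand j'" by (rule crossing_cases)
    have "j' = j" "p' $ 2 = p $ 2" using j(1) j'(1) eq by (auto simp: proj_eq_iff)
    then have "p = p' \<and> u = u'"
      using j(2) j'(2) eq proj_left_left proj_right_right by (metis (full_types))
    then show "c = d" by (simp add: pair)
  qed
  define X where "X = (\<lambda>(j, y). (2 * real j + 1 / 2, y)) ` ({..<m} \<times> {1 / 2, 3 / 2 :: real})"
  have sub: "f ` crossings chain \<subseteq> X"
  proof (rule image_subsetI)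
    fix c assume c: "c \<in> crossings chain"
    obtain p u where pair: "c = (p, u)" by (metis surj_pair)
    from c[unfolded pair] obtain j where "j < m" "p $ 1 = 2 * real j + 1 / 2" "p $ 2 = 1 / 2 \<or> p $ 2 = 3 / 2"
      by (rule crossing_cases)
    then show "f c \<in> X" unfolding X_def f_def proj_def pair by force
  qed
  have fin: "finite X" by (simp add: X_def)
  have "card X \<le> card ({..<m} \<times> {1 / 2, 3 / 2 :: real})" unfolding X_def by (rule card_image_le) simp
  then have "card X \<le> 2 * m" by (simp add: card_cartesian_product)
  moreover have "card (crossings chain) \<le> card X" using card_inj_on_le[OF inj sub fin] .
  ultimately show ?thesis using inj_on_finite[OF inj sub fin] by simp
qed

lemma vertices_off_crossings:
  assumes "v \<in> set (vertices i)" shows "\<bar>v $ 2 - 1\<bar> \<noteq> 1 / 2"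
proof -
  have "v $ 2 \<in> {0, 1, 2, - 1, 2 * real m + 1}"
    using assms by (auto simp: vertices_def hexagon_def decagon_def split: if_splits)
  then show ?thesis using m_real by auto
qed

lemma regular_chain: "regular_position (vertices ` {..<m})"
  unfolding regular_position_def carrier_chain
proof (intro conjI ballI, use crossings_bound in blast, clarify, intro conjI allI impI ballI)
  fix p u assume c: "(p, u) \<in> crossings chain"
  then have pu: "p \<in> chain" "u \<in> chain" "proj p = proj u" "u $ 3 < p $ 3" "p \<noteq> u"
    by (auto simp: crossings_def)
  have "x = u" if x: "x \<in> chain" "proj x = proj p" "x \<noteq> p" for x
  proof -
    obtain j where j: "p \<in> left_strand j \<and> u \<in> right_strand j \<or> p \<in> right_strand j \<and> u \<in> left_strand j"
      using same_projection pu by blast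
    obtain j' where j': "p \<in> left_strand j' \<and> x \<in> right_strand j' \<or> p \<in> right_strand j' \<and> x \<in> left_strand j'"
      using same_projection[OF pu(1) x(1)] x by metis
    moreover have "proj x = proj u" using x pu by simp
    ultimately show ?thesis using j left_right_disjoint proj_left_left proj_right_right by metis
  qed
  then show "{x \<in> chain. proj x = proj p} = {p, u}" using pu by auto
  fix vs assume "vs \<in> vertices ` {..<m}"
  moreover have "\<bar>p $ 2 - 1\<bar> = 1 / 2" "\<bar>u $ 2 - 1\<bar> = 1 / 2"
    using same_projection[OF pu(1,2,3,5)] pu(3) by (auto simp: proj_eq_iff)
  ultimately show "p \<notin> set vs" "u \<notin> set vs" using vertices_off_crossings by blast+
qed

lemma diagram_chain: "diagram chain"
  unfolding diagram_def using polygonal_link_chain regular_chain carrier_chain by metis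

section \<open>The coloring with four colors\<close>

lemma compact_ring: "i < m \<Longrightarrow> compact (ring i)"
  unfolding closed_vertices[symmetric] closed_polygon_def polygon_edge_def
  by (intro compact_UN) auto

text \<open>The common level of all under points of the ring with index \<open>i\<close>.\<close>

definition cut_level :: "nat \<Rightarrow> real" where
  "cut_level i = (if even i then 1 / 2 else 3 / 2)"

lemma crossing_rings:
  assumes "(p, u) \<in> crossings chain"
  obtains i k where "i < m" "k < m" "p \<in> ring i" "u \<in> ring k" "odd (i + k)" "p $ 2 = cut_level k" "u $ 2 = cut_level k"
    "u \<in> left_strand (Suc k mod m) \<or> u \<in> right_strand k"
  using assms
proof (rule crossing_cases)
  fix j assume j: "j < m" "p $ 2 = 1 / 2 \<or> p $ 2 = 3 / 2"
    "if even j = (p $ 2 = 1 / 2) then p \<in> left_strand j \<and> u \<in> right_strand j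
      else p \<in> right_strand j \<and> u \<in> left_strand j"
  have u2: "u $ 2 = p $ 2" using assms by (auto simp: crossings_def proj_eq_iff)
  obtain i where i: "i < m" "left_strand j \<subseteq> ring i" "odd (i + j)" "Suc i mod m = j"
    using left_subset_ring[OF j(1)] by blast
  note r = right_subset_ring[of j]
  show thesis
  proof (cases "even j = (p $ 2 = 1 / 2)")
    case True
    then have "p $ 2 = cut_level j" using j(2) by (auto simp: cut_level_def)
    then show thesis using that[of i j] True i r j u2 by auto
  next
    case False
    then have "p $ 2 = cut_level i" using j(2) i(3) by (auto simp: cut_level_def)
    then show thesis using that[of j i] False i r j u2 by (auto simp: add.commute)
  qed
qed

text \<open>A ring is the right strand in one column and the left strand in the next column, which has the
  opposite twist. Exchanging left and right and changing the twist have opposite effects on which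
  of the two crossings is an under crossing, so it is the same one in both columns.\<close>

lemma cut_level_is_under:
  assumes "p \<in> ring i" "i < m" "p $ 2 = cut_level i"
  shows "p \<in> snd ` crossings chain"
proof -
  have y: "\<bar>p $ 2 - 1\<bar> = 1 / 2" using assms(3) by (simp add: cut_level_def)
  have nb: "p \<notin> bridges i" "p \<notin> frame"
    using y m_real by (auto simp: bridges_def frame_def)
  have k: "Suc i mod m < m" using m_ge by simp
  have par: "even (Suc i mod m) \<longleftrightarrow> odd i" using m_even assms(2) by (auto simp: mod_Suc)
  consider "p \<in> right_strand i" | "p \<in> left_strand (Suc i mod m)"
    using assms(1) nb unfolding ring_def by (auto split: if_splits)
  then show ?thesis
  proof cases
    case 1
    define q :: "real^3" where "q = vector [p $ 1, p $ 2, twist i / 2]"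
    have "q \<in> left_strand i" using 1 y by (auto simp: q_def left_strand_def right_strand_def)
    moreover have "p $ 3 < q $ 3"
      using 1 assms(3) by (auto simp: q_def right_strand_def cut_level_def twist_def)
    ultimately have "(q, p) \<in> crossings chain"
      using 1 strands_subset_chain[OF assms(2)] by (auto simp: crossings_def proj_eq_iff q_def)
    then show ?thesis by force
  next
    case 2
    define j where "j = Suc i mod m"
    define q :: "real^3" where "q = vector [p $ 1, p $ 2, 2 * twist j * max 0 (p $ 2 - 1)]"
    have "q \<in> right_strand j" using 2 y by (auto simp: q_def left_strand_def right_strand_def j_def)
    moreover have "p $ 3 < q $ 3"
      using 2 assms(3) par y by (auto simp: q_def left_strand_def cut_level_def twist_def j_def split: if_splits)
    ultimately have "(q, p) \<in> crossings chain"
      using 2 strands_subset_chain[OF k] by (auto simp: crossings_def proj_eq_iff q_def j_def)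
    then show ?thesis by force
  qed
qed

lemma under_height: "u \<in> snd ` crossings chain \<Longrightarrow> u $ 2 = 1 / 2 \<or> u $ 2 = 3 / 2"
  by (auto elim!: crossing_rings simp: cut_level_def)

definition ring_color :: "nat \<Rightarrow> real \<Rightarrow> int" where
  "ring_color i y = (if y < cut_level i then 0 else 2) + (if even i then 0 else 1)"

definition even_rings :: "(real^3) set" where
  "even_rings = (\<Union>i\<in>{i. i < m \<and> even i}. ring i)"

definition odd_rings :: "(real^3) set" where
  "odd_rings = (\<Union>i\<in>{i. i < m \<and> odd i}. ring i)"

text \<open>The color is read off at any point of the arc; it does not depend on the point since an arc lies
  on one ring and does not pass its cut level.\<close>

definition arc_color :: "(real^3) set \<Rightarrow> int" where
  "arc_color A = (SOME c. \<exists>i<m. \<exists>p\<in>A. p \<in> ring i \<and> c = ring_color i (p $ 2))"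

lemma chain_ring: "p \<in> chain \<Longrightarrow> \<exists>i<m. p \<in> ring i"
  by (auto simp: chain_def)

lemma connected_above_or_below:
  fixes A :: "(real^'n) set"
  assumes "connected A" "\<And>p. p \<in> A \<Longrightarrow> p $ k \<noteq> c" "p \<in> A" "q \<in> A"
  shows "p $ k < c \<longleftrightarrow> q $ k < c"
proof -
  have "open {x :: real^'n. x $ k < c}" "open {x :: real^'n. c < x $ k}"
    by (simp_all add: open_halfspace_component_lt_cart open_halfspace_component_gt_cart)
  moreover have "A \<subseteq> {x. x $ k < c} \<union> {x. c < x $ k}" using assms(2) by force
  moreover have "{x. x $ k < c} \<inter> {x. c < x $ k} \<inter> A = {}" by auto
  ultimately have "{x. x $ k < c} \<inter> A = {} \<or> {x. c < x $ k} \<inter> A = {}"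
    using assms(1) by (meson connectedD)
  then show ?thesis using assms(2-4) by force
qed

text \<open>Only the parity of the ring matters for its colors. An arc cannot change parity, because the even
  rings and the odd rings form disjoint closed sets, and it cannot pass the cut level, because
  all points of a ring at that level are under points.\<close>

lemma ring_color_const:
  assumes A: "A \<in> arcs chain" and p: "p \<in> A" "p \<in> ring i" "i < m" and q: "q \<in> A" "q \<in> ring k" "k < m"
  shows "ring_color i (p $ 2) = ring_color k (q $ 2)"
proof -
  have conn: "connected A" and sub: "A \<subseteq> chain - snd ` crossings chain"
    using A in_components_connected in_components_subset unfolding arcs_def by blast+
  have cl: "closed even_rings" "closed odd_rings"
    unfolding even_rings_def odd_rings_def by (auto intro!: closed_UN simp: compact_imp_closed compact_ring)
  have cover: "A \<subseteq> even_rings \<union> odd_rings"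
    using sub chain_ring unfolding even_rings_def odd_rings_def by blast
  have "even_rings \<inter> odd_rings \<inter> A = {}"
    using ring_unique by (auto simp: even_rings_def odd_rings_def)
  then have "even_rings \<inter> A = {} \<or> odd_rings \<inter> A = {}"
    using conn cl cover by (meson connected_closedD)
  moreover have mem: "x \<in> even_rings \<longleftrightarrow> even l" "x \<in> odd_rings \<longleftrightarrow> odd l" if "x \<in> ring l" "l < m" for x l
    using that ring_unique by (auto simp: even_rings_def odd_rings_def)
  ultimately have same: "even l \<longleftrightarrow> even i" if "x \<in> A" "x \<in> ring l" "l < m" for x l
    using p that by blast
  then have cut_level: "cut_level l = cut_level i" if "x \<in> A" "x \<in> ring l" "l < m" for x l
    using that by (simp add: cut_level_def)
  have "x $ 2 \<noteq> cut_level i" if x: "x \<in> A" for x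
  proof
    assume e: "x $ 2 = cut_level i"
    obtain l where l: "l < m" "x \<in> ring l" using x sub chain_ring by blast
    then have "x \<in> snd ` crossings chain" using cut_level_is_under e cut_level x by metis
    then show False using x sub by blast
  qed
  from connected_above_or_below[OF conn this p(1) q(1)] show ?thesis
    using same[OF q] cut_level[OF q] by (simp add: ring_color_def)
qed

lemma arc_color_eq:
  assumes "A \<in> arcs chain" "p \<in> A" "p \<in> ring i" "i < m"
  shows "arc_color A = ring_color i (p $ 2)"
  unfolding arc_color_def
proof (rule some_equality)
  show "\<exists>i'<m. \<exists>p'\<in>A. p' \<in> ring i' \<and> ring_color i (p $ 2) = ring_color i' (p' $ 2)"
    using assms by blast
qed (use ring_color_const assms in metis)

lemma arc_containing:
  assumes "T \<subseteq> chain - snd ` crossings chain" "connected T" "p \<in> T"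
  obtains A where "A \<in> arcs chain" "T \<subseteq> A"
  using assms exists_component_superset[of T "chain - snd ` crossings chain"] unfolding arcs_def
  by (metis empty_iff equals0D subset_empty)

text \<open>Just below and just above the cut level the strand contains no under points. These two pieces
  extend to arcs, and the colors of the arcs can be read off on the pieces. That the arcs have
  different colors shows that they are different.\<close>

lemma arcs_at_strand:
  fixes \<sigma> :: "real \<Rightarrow> real^3"
  assumes cont: "continuous_on UNIV \<sigma>" and \<sigma>: "\<And>t. 0 \<le> t \<Longrightarrow> t \<le> 2 \<Longrightarrow> \<sigma> t \<in> ring k \<and> \<sigma> t $ 2 = t"
    and k: "k < m"
  shows "\<exists>A\<in>arcs chain. \<exists>B\<in>arcs chain. \<sigma> (cut_level k) \<in> closure A \<and> \<sigma> (cut_level k) \<in> closure B \<and>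
    arc_color A + 2 = arc_color B \<and> arc_color A = (if even k then 0 else 1)"
proof -
  define c where "c = cut_level k"
  have c: "c = 1 / 2 \<or> c = 3 / 2" by (simp add: c_def cut_level_def)
  have arc: "\<exists>A\<in>arcs chain. \<sigma> c \<in> closure A \<and> arc_color A = ring_color k t"
    if S: "connected S" "t \<in> S" "c \<in> closure S" "S \<subseteq> {0..2} - {1 / 2, 3 / 2}" for S t
  proof -
    have "\<sigma> ` S \<subseteq> chain - snd ` crossings chain"
    proof clarify
      fix s assume s: "s \<in> S"
      then have "0 \<le> s" "s \<le> 2" "s \<noteq> 1 / 2" "s \<noteq> 3 / 2" using S(4) by auto
      then show "\<sigma> s \<in> chain - snd ` crossings chain"
        using \<sigma>[of s] under_height[of "\<sigma> s"] ring_subset_chain[OF k] by auto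
    qed
    moreover have "connected (\<sigma> ` S)"
      using cont S(1) by (meson connected_continuous_image continuous_on_subset subset_UNIV)
    ultimately obtain A where A: "A \<in> arcs chain" "\<sigma> ` S \<subseteq> A"
      using arc_containing S(2) by blast
    have "\<sigma> c \<in> closure (\<sigma> ` S)"
      using image_closure_subset[of S \<sigma> "closure (\<sigma> ` S)"] cont S(3) closure_subset
      by (meson closed_closure continuous_on_subset image_subset_iff subset_UNIV)
    then have "\<sigma> c \<in> closure A" using A(2) closure_mono by blast
    moreover have "arc_color A = ring_color k t"
    proof -
      have "0 \<le> t" "t \<le> 2" using S(2,4) by auto
      then show ?thesis using arc_color_eq[OF A(1), of "\<sigma> t" k] A(2) S(2) \<sigma>[of t] k by auto
    qed
    ultimately show ?thesis using A(1) by blast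
  qed
  have "\<exists>A\<in>arcs chain. \<sigma> c \<in> closure A \<and> arc_color A = ring_color k (c - 1 / 4)"
    using c by (intro arc[of "{c - 1/4..<c}"]) auto
  moreover have "\<exists>A\<in>arcs chain. \<sigma> c \<in> closure A \<and> arc_color A = ring_color k (c + 1 / 4)"
    using c by (intro arc[of "{c<..c + 1/4}"]) auto
  moreover have "ring_color k (c - 1 / 4) = (if even k then 0 else 1)"
    "ring_color k (c + 1 / 4) = ring_color k (c - 1 / 4) + 2"
    by (auto simp: ring_color_def c_def)
  ultimately show ?thesis unfolding c_def by metis
qed

definition left_path :: "nat \<Rightarrow> real \<Rightarrow> real^3" where
  "left_path j t = vector [2 * real j + 1 - \<bar>t - 1\<bar>, t, twist j * (1 - \<bar>t - 1\<bar>)]"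

definition right_path :: "nat \<Rightarrow> real \<Rightarrow> real^3" where
  "right_path j t = vector [2 * real j + \<bar>t - 1\<bar>, t, 2 * twist j * max 0 (t - 1)]"

lemma continuous_on_vector3:
  assumes "continuous_on S f" "continuous_on S g" "continuous_on S h"
  shows "continuous_on S (\<lambda>t. vector [f t, g t, h t] :: real^3)"
proof -
  have "(\<lambda>t. vector [f t, g t, h t] :: real^3) = (\<lambda>t. \<chi> i. if i = 1 then f t else if i = 2 then g t else h t)"
    by (rule ext) (simp add: vec3_eq_iff)
  moreover have "continuous_on S (\<lambda>t. (\<chi> i. if i = 1 then f t else if i = 2 then g t else h t) :: real^3)"
  proof (rule continuous_on_vec_lambda)
    fix i :: 3 show "continuous_on S (\<lambda>t. if i = 1 then f t else if i = 2 then g t else h t)"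
      using assms by (cases "i = 1"; cases "i = 2") auto
  qed
  ultimately show ?thesis by metis
qed

lemma left_path:
  "continuous_on UNIV (left_path j)" "0 \<le> t \<Longrightarrow> t \<le> 2 \<Longrightarrow> left_path j t \<in> left_strand j"
  "left_path j t $ 2 = t" "p \<in> left_strand j \<Longrightarrow> p = left_path j (p $ 2)"
  unfolding left_path_def
  by (auto intro!: continuous_on_vector3 continuous_intros simp: left_strand_def vec3_eq_iff)

lemma right_path:
  "continuous_on UNIV (right_path j)" "0 \<le> t \<Longrightarrow> t \<le> 2 \<Longrightarrow> right_path j t \<in> right_strand j"
  "right_path j t $ 2 = t" "p \<in> right_strand j \<Longrightarrow> p = right_path j (p $ 2)"
  unfolding right_path_def
  by (auto intro!: continuous_on_vector3 continuous_intros simp: right_strand_def vec3_eq_iff)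

lemma next_left_subset_ring: "left_strand (Suc k mod m) \<subseteq> ring k"
  by (auto simp: ring_def)

lemma arcs_at_under_point:
  assumes u: "u \<in> left_strand (Suc k mod m) \<or> u \<in> right_strand k" "u $ 2 = cut_level k" and k: "k < m"
  shows "\<exists>A\<in>arcs chain. \<exists>B\<in>arcs chain. u \<in> closure A \<and> u \<in> closure B \<and>
    arc_color A + 2 = arc_color B \<and> arc_color A = (if even k then 0 else 1)"
  using u(1)
proof
  assume "u \<in> left_strand (Suc k mod m)"
  then have "u = left_path (Suc k mod m) (cut_level k)" using left_path(4) u(2) by metis
  then show ?thesis
    using arcs_at_strand[of "left_path (Suc k mod m)" k] left_path next_left_subset_ring k by blast
next
  assume "u \<in> right_strand k"
  then have "u = right_path k (cut_level k)" using right_path(4) u(2) by metis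
  then show ?thesis
    using arcs_at_strand[of "right_path k" k] right_path right_subset_ring k by blast
qed

lemma Z_coloring_arc_color: "Z_coloring chain arc_color"
  unfolding Z_coloring_def
proof (clarify)
  fix p u a b c
  assume pu: "(p, u) \<in> crossings chain" and abc: "a \<in> arcs chain" "p \<in> a"
    and bc: "{A \<in> arcs chain. u \<in> closure A} = {b, c}"
  from pu obtain i k where ik: "i < m" "k < m" "p \<in> ring i" "u \<in> ring k" "odd (i + k)" "p $ 2 = cut_level k"
     "u $ 2 = cut_level k" "u \<in> left_strand (Suc k mod m) \<or> u \<in> right_strand k"
    by (rule crossing_rings)
  obtain A B where AB: "A \<in> arcs chain" "B \<in> arcs chain" "u \<in> closure A" "u \<in> closure B"
    "arc_color A + 2 = arc_color B" "arc_color A = (if even k then 0 else 1)"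
    using arcs_at_under_point[OF ik(8,7,2)] by blast
  \<comment> \<open>Two distinct arcs ending at \<open>u\<close> have been found, so they are \<open>b\<close> and \<open>c\<close> in some order.\<close>
  have "A \<noteq> B" using AB(5) by auto
  then have "arc_color b + arc_color c = arc_color A + arc_color B"
  proof -
    have "A \<in> {b, c}" "B \<in> {b, c}" using AB(1-4) bc by blast+
    then show ?thesis using \<open>A \<noteq> B\<close> by auto
  qed
  moreover have "arc_color a = ring_color i (cut_level k)"
    using arc_color_eq[OF abc ik(3,1)] ik(6) by simp
  ultimately show "2 * arc_color a = arc_color b + arc_color c"
    using AB(5,6) ik(5) by (auto simp: ring_color_def cut_level_def)
qed

lemma colors_arc_color: "colors chain arc_color = {0, 1, 2, 3}"
proof
  show "colors chain arc_color \<subseteq> {0, 1, 2, 3}"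
  proof (clarsimp simp: colors_def)
    fix A assume A: "A \<in> arcs chain" "arc_color A \<noteq> 0" "arc_color A \<noteq> 1" "arc_color A \<noteq> 2"
    have "A \<noteq> {}" "A \<subseteq> chain"
      using A(1) in_components_nonempty in_components_subset unfolding arcs_def by blast+
    then obtain p i where "p \<in> A" "i < m" "p \<in> ring i" using chain_ring by blast
    then have "arc_color A = ring_color i (p $ 2)" using arc_color_eq A(1) by blast
    then show "arc_color A = 3" using A by (auto simp: ring_color_def split: if_splits)
  qed
  have color: "ring_color k t \<in> colors chain arc_color" if "k < m" "t \<in> {0, 1, 2}" for k t
  proof -
    have t: "0 \<le> t" "t \<le> 2" using that by auto
    have p: "right_path k t \<in> ring k" using right_path(2)[OF t] right_subset_ring by blast
    have "right_path k t $ 2 \<noteq> 1 / 2" "right_path k t $ 2 \<noteq> 3 / 2"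
      using that(2) right_path(3)[of k t] by auto
    then have "right_path k t \<notin> snd ` crossings chain" using under_height by blast
    then have "{right_path k t} \<subseteq> chain - snd ` crossings chain"
      using p ring_subset_chain[OF that(1)] by (metis DiffI empty_subsetI insert_subset subsetD)
    then obtain A where A: "A \<in> arcs chain" "{right_path k t} \<subseteq> A"
      by (rule arc_containing) auto
    then have "arc_color A = ring_color k t" using arc_color_eq[OF A(1) _ p that(1)] right_path(3) by auto
    then show ?thesis using A(1) unfolding colors_def by (metis imageI)
  qed
  show "{0, 1, 2, 3} \<subseteq> colors chain arc_color"
    using color[of 0 0] color[of 0 1] color[of 1 1] color[of 1 2] m_ge by (simp add: ring_color_def cut_level_def)
qed

section \<open>Neighbouring rings are linked\<close>

text \<open>Positive outside, zero on and negative inside the convex hexagon that is the projection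
  of ring \<open>i\<close>, provided that this is not the last ring.\<close>

definition hex_gauge :: "nat \<Rightarrow> real^3 \<Rightarrow> real" where
  "hex_gauge i p = max (\<bar>p $ 2 - 1\<bar> - 1) (\<bar>p $ 1 - 2 * real i - 3 / 2\<bar> + \<bar>p $ 2 - 1\<bar> - 3 / 2)"

text \<open>A continuous function of the projection that gives the third coordinate on ring \<open>i\<close>: the first
  summand is the height on the right strand of column \<open>i\<close>, falling to \<open>0\<close> along the upper bridge,
  and the second one is the height on the left strand of the next column.\<close>

definition hex_height :: "nat \<Rightarrow> real^3 \<Rightarrow> real" where
  "hex_height i p = 2 * twist i * max 0 (p $ 2 - 1) * max 0 (min 1 (2 * real i + 2 - p $ 1))
     - twist i * max 0 (p $ 1 - 2 * real i - 2)"

text \<open>Its zeros are the points over the hexagon at the height of the ring, that is, the points of the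
  ring. The shear by \<open>\<kappa>\<close> leaves the zeros unchanged; it adjusts the values on the strand
  of a linked ring to those in \<open>triangle_not_contractible_off\<close>.\<close>

definition ring_map :: "real \<Rightarrow> nat \<Rightarrow> real^3 \<Rightarrow> complex" where
  "ring_map \<kappa> i p = Complex (hex_gauge i p) (p $ 3 - hex_height i p + \<kappa> * hex_gauge i p)"

lemma continuous_ring_map: "continuous_on UNIV (ring_map \<kappa> i)"
  unfolding ring_map_def hex_gauge_def hex_height_def Complex_eq
  by (intro continuous_intros)

lemma ring_map_zero:
  assumes "Suc i < m" "ring_map \<kappa> i p = 0"
  shows "p \<in> ring i"
proof -
  define x y where "x = p $ 1 - 2 * real i" and "y = p $ 2 - 1"
  have g: "max (\<bar>y\<bar> - 1) (\<bar>x - 3 / 2\<bar> + \<bar>y\<bar> - 3 / 2) = 0"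
    using assms(2) by (simp add: ring_map_def hex_gauge_def complex_eq_iff x_def y_def)
  have "p $ 3 = hex_height i p" using assms(2) by (auto simp: ring_map_def complex_eq_iff)
  moreover have "2 * real i + 2 - p $ 1 = 2 - x" "p $ 1 - 2 * real i - 2 = x - 2" by (simp_all add: x_def)
  ultimately have h: "p $ 3 = 2 * twist i * max 0 y * max 0 (min 1 (2 - x)) - twist i * max 0 (x - 2)"
    unfolding hex_height_def by (simp add: y_def)
  consider "\<bar>y\<bar> \<le> 1" "x = \<bar>y\<bar>" | "\<bar>y\<bar> \<le> 1" "x = 3 - \<bar>y\<bar>" | "\<bar>y\<bar> = 1" "1 \<le> x" "x \<le> 2"
    using g by (auto simp: max_def abs_if split: if_splits; linarith)
  then show ?thesis
  proof cases
    case 1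
    then have "max 0 (min 1 (2 - x)) = 1" "max 0 (x - 2) = 0" by auto
    then have "p \<in> right_strand i" using 1 h by (auto simp: right_strand_def x_def y_def)
    then show ?thesis by (simp add: ring_def)
  next
    case 2
    then have "max 0 (min 1 (2 - x)) = 0" "max 0 (x - 2) = 1 - \<bar>y\<bar>" by auto
    then have "p \<in> left_strand (Suc i)" using 2 h by (auto simp: left_strand_def x_def y_def twist_Suc)
    then show ?thesis using assms(1) by (simp add: ring_def)
  next
    case 3
    then have "max 0 (min 1 (2 - x)) = 2 - x" "max 0 (x - 2) = 0" by auto
    moreover have "y = 1 \<or> y = - 1" using 3(1) by auto
    ultimately have "p \<in> bridges i" using 3 h by (auto simp: bridges_def x_def y_def)
    then show ?thesis using assms(1) by (simp add: ring_def)
  qed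
qed

lemma connected_strands: "connected (left_strand j)" "connected (right_strand j)"
  unfolding left_strand_eq_segments right_strand_eq_segments
  by (intro connected_Un; auto)+

definition upper_frame :: "(real^3) set" where
  "upper_frame =
    closed_segment (vector [2 * real m - 1, 2, - 2]) (vector [2 * real m - 1, 2 * real m + 1, 0]) \<union>
    closed_segment (vector [2 * real m - 1, 2 * real m + 1, 0]) (vector [0, 2 * real m + 1, 0]) \<union>
    closed_segment (vector [0, 2 * real m + 1, 0]) (vector [0, 2, 0])"

definition lower_frame :: "(real^3) set" where
  "lower_frame =
    closed_segment (vector [2 * real m - 1, 0, 0]) (vector [2 * real m - 1, - 1, 0]) \<union>
    closed_segment (vector [2 * real m - 1, - 1, 0]) (vector [0, - 1, 0]) \<union>
    closed_segment (vector [0, - 1, 0]) (vector [0, 0, 0])"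

lemma frame_split: "frame = upper_frame \<union> lower_frame"
  unfolding frame_eq_segments upper_frame_def lower_frame_def by (simp only: Un_ac)

lemma connected_half_frames: "connected upper_frame" "connected lower_frame"
  unfolding upper_frame_def lower_frame_def by (intro connected_Un; auto)+

lemma connected_between:
  assumes "connected X" "connected Y" "connected Z" "x \<in> X" "x \<in> Y" "y \<in> Y" "y \<in> Z"
  shows "connected (X \<union> Y \<union> Z)"
  using assms by (intro connected_Un) auto

lemma strand_ends:
  "vector [2 * real j, 2, 0] \<in> left_strand j" "vector [2 * real j, 0, 0] \<in> left_strand j"
  "vector [2 * real j + 1, 2, 2 * twist j] \<in> right_strand j" "vector [2 * real j + 1, 0, 0] \<in> right_strand j"
  by (auto simp: left_strand_def right_strand_def)

lemma frame_ends:
  "vector [2 * real m - 1, 2, - 2] \<in> upper_frame" "vector [0, 2, 0] \<in> upper_frame"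
  "vector [2 * real m - 1, 0, 0] \<in> lower_frame" "vector [0, 0, 0] \<in> lower_frame"
  unfolding upper_frame_def lower_frame_def by auto

lemma frame_gauge:
  assumes "p \<in> frame" "Suc i < m"
  shows "0 < hex_gauge i p"
proof -
  have "real i + 2 \<le> real m" using assms(2) by linarith
  then have "\<bar>p $ 2 - 1\<bar> > 1 \<or> \<bar>p $ 2 - 1\<bar> \<ge> 1 \<and> \<bar>p $ 1 - 2 * real i - 3 / 2\<bar> \<ge> 3 / 2"
    using assms(1) m_real unfolding frame_def by auto
  then show ?thesis unfolding hex_gauge_def by auto
qed

lemma far_gauge:
  assumes "p $ 1 \<ge> 2 * real i + 4 \<or> p $ 1 \<le> 2 * real i - 1"
  shows "0 < hex_gauge i p"
  using assms unfolding hex_gauge_def by auto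

text \<open>The right strand of column \<open>Suc i\<close> is the only part of the next ring whose projection enters the
  hexagon of ring \<open>i\<close>. It consists of two segments, and the vertex between them is mapped
  to \<open>-1\<close>.\<close>

lemma ring_next_not_contractible:
  assumes i: "Suc i < m"
  shows "\<not> contractible_off (ring (Suc i)) (ring i)"
proof -
  define j where "j = Suc i"
  have j: "real j = real i + 1" "twist i = - twist j" by (simp_all add: j_def twist_Suc)
  define P M Q :: "real^3" where "P = vector [2 * real j + 1, 0, 0]" and "M = vector [2 * real j, 1, 0]"
    and "Q = vector [2 * real j + 1, 2, 2 * twist j]"
  define T where "T = left_strand (Suc j mod m) \<union> (if Suc j < m then bridges j else frame)"
  have T: "connected T \<and> P \<in> T \<and> Q \<in> T \<and> (\<forall>p\<in>T. 0 < hex_gauge i p)"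
  proof (cases "Suc j < m")
    case True
    let ?X = "closed_segment (vector [2 * real j + 1, 2, 2 * twist j]) (vector [2 * real j + 2, 2, 0]) :: (real^3) set"
    let ?Z = "closed_segment (vector [2 * real j + 1, 0, 0]) (vector [2 * real j + 2, 0, 0]) :: (real^3) set"
    have T_eq: "T = ?X \<union> left_strand (Suc j) \<union> ?Z"
      using True by (auto simp: T_def bridges_eq_segments)
    have "connected T"
      unfolding T_eq using strand_ends(1,2)[of "Suc j"]
      by (intro connected_between[of _ _ _ "vector [2 * real j + 2, 2, 0]" "vector [2 * real j + 2, 0, 0]"])
        (auto simp: connected_strands add.commute)
    moreover have "0 < hex_gauge i p" if pT: "p \<in> T" for p
    proof -
      consider "p \<in> left_strand (Suc j)" | "p \<in> bridges j" using pT True by (auto simp: T_def)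
      then show ?thesis
      proof cases
        case 1
        then show ?thesis by (intro far_gauge) (auto simp: left_strand_def j)
      next
        case 2
        then show ?thesis by (auto simp: hex_gauge_def bridges_def j)
      qed
    qed
    ultimately show ?thesis unfolding P_def Q_def by (auto simp: T_eq)
  next
    case False
    then have last: "j = m - 1" "Suc j mod m = 0" using i by (auto simp: j_def mod_Suc)
    then have rj: "2 * real j + 1 = 2 * real m - 1" using m_ge by (simp add: of_nat_diff)
    have T_eq: "T = upper_frame \<union> left_strand 0 \<union> lower_frame"
      using False last by (auto simp: T_def frame_split)
    have "connected T"
      unfolding T_eq using strand_ends(1,2)[of 0] frame_ends
      by (intro connected_between[of _ _ _ "vector [0, 2, 0]" "vector [0, 0, 0]"])
        (auto simp: connected_strands connected_half_frames)
    moreover have "0 < hex_gauge i p" if pT: "p \<in> T" for p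
    proof -
      consider "p \<in> left_strand 0" | "p \<in> frame" using pT False last by (auto simp: T_def)
      then show ?thesis
      proof cases
        case 1
        have "1 \<le> real i" using last i m_ge by (simp add: j_def)
        then show ?thesis using 1 by (intro far_gauge) (auto simp: left_strand_def)
      next
        case 2
        then show ?thesis using frame_gauge i by blast
      qed
    qed
    moreover have "twist j = - 1" using twist_last last by simp
    ultimately show ?thesis unfolding P_def Q_def T_eq using frame_ends by (simp add: rj)
  qed
  have right: "closed_segment P M \<union> closed_segment M Q = right_strand j"
    unfolding P_def Q_def M_def right_strand_eq_segments ..
  have A: "closed_segment P M \<union> closed_segment M Q \<union> T \<subseteq> ring j"
    unfolding right T_def ring_def by auto
  show ?thesis
    unfolding j_def[symmetric]
  proof (rule triangle_not_contractible_off[OF continuous_ring_map _ _ _ _ _ A twist_cases])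
    show "p \<in> ring i" if "ring_map 0 i p = 0" for p using ring_map_zero i that by blast
    fix t :: real assume t: "0 \<le> t" "t \<le> 1"
    show "ring_map 0 i ((1 - t) *\<^sub>R P + t *\<^sub>R M) = Complex (1 - 2 * t) (- twist j * (1 - t))"
      using t by (simp add: ring_map_def hex_gauge_def hex_height_def P_def M_def j algebra_simps)
    show "ring_map 0 i ((1 - t) *\<^sub>R M + t *\<^sub>R Q) = Complex (2 * t - 1) (twist j * t)"
      using t by (simp add: ring_map_def hex_gauge_def hex_height_def Q_def M_def j algebra_simps)
  qed (use T in \<open>auto simp: ring_map_def\<close>)
qed

text \<open>The last ring enters the hexagon of ring \<open>0\<close> with the left strand of column \<open>0\<close>. On this strand
  the map with \<open>\<kappa> = 0\<close> takes the middle vertex to \<open>-1 + \<i>\<close>; the shear with \<open>\<kappa> = 1\<close> moves it to \<open>-1\<close>.\<close>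

lemma ring_last_not_contractible: "\<not> contractible_off (ring (m - 1)) (ring 0)"
proof -
  define P M Q :: "real^3" where "P = vector [0, 0, 0]" and "M = vector [1, 1, 1]" and "Q = vector [0, 2, 0]"
  define T where "T = upper_frame \<union> right_strand (m - 1) \<union> lower_frame"
  have i: "Suc 0 < m" and "real (m - 1) = real m - 1" using m_ge by (auto simp: of_nat_diff)
  then have rj: "2 * real (m - 1) + 1 = 2 * real m - 1" by simp
  have conn: "connected T"
    unfolding T_def using strand_ends(3,4)[of "m - 1"] frame_ends
    by (intro connected_between[of _ _ _ "vector [2 * real m - 1, 2, - 2]" "vector [2 * real m - 1, 0, 0]"])
      (auto simp: connected_strands connected_half_frames rj twist_last simp del: One_nat_def)
  have pos: "0 < hex_gauge 0 p" if pT: "p \<in> T" for p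
  proof -
    consider "p \<in> right_strand (m - 1)" | "p \<in> frame" using pT by (auto simp: T_def frame_split)
    then show ?thesis
    proof cases
      case 1
      have "3 \<le> real (m - 1)" using m_ge by simp
      then show ?thesis using 1 by (intro far_gauge) (auto simp: right_strand_def)
    next
      case 2
      then show ?thesis using frame_gauge i by blast
    qed
  qed
  have tw: "twist 0 = 1" by (simp add: twist_def)
  have left: "closed_segment P M \<union> closed_segment M Q = left_strand 0"
    unfolding P_def Q_def M_def left_strand_eq_segments tw by simp
  have A: "closed_segment P M \<union> closed_segment M Q \<union> T \<subseteq> ring (m - 1)"
    unfolding left T_def ring_def frame_split using m_ge by auto
  show ?thesis
  proof (rule triangle_not_contractible_off[OF continuous_ring_map _ conn _ _ _ A, where \<tau> = "-1"])
    show "p \<in> ring 0" if "ring_map 1 0 p = 0" for p using ring_map_zero i that by blast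
    fix t :: real assume t: "0 \<le> t" "t \<le> 1"
    show "ring_map 1 0 ((1 - t) *\<^sub>R P + t *\<^sub>R M) = Complex (1 - 2 * t) (- (- 1) * (1 - t))"
      using t by (simp add: ring_map_def hex_gauge_def hex_height_def P_def M_def tw)
    show "ring_map 1 0 ((1 - t) *\<^sub>R M + t *\<^sub>R Q) = Complex (2 * t - 1) (- 1 * t)"
      using t by (simp add: ring_map_def hex_gauge_def hex_height_def Q_def M_def tw)
  qed (use pos frame_ends in \<open>auto simp: ring_map_def T_def P_def Q_def\<close>)
qed

end

section \<open>Counting the crossings of an arbitrary diagram\<close>

text \<open>If \<open>A\<close> were never above \<open>B\<close>, or never below it, then it could be moved away from \<open>B\<close> vertically.\<close>

lemma crossings_if_not_contractible_off:
  assumes "compact A" "compact B" "A \<inter> B = {}" "A \<union> B \<subseteq> D" "\<not> contractible_off A B"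
  shows "\<exists>c\<in>crossings D. fst c \<in> A \<and> snd c \<in> B" "\<exists>c\<in>crossings D. fst c \<in> B \<and> snd c \<in> A"
proof -
  have ne: "a $ 3 \<noteq> b $ 3" if "a \<in> A" "b \<in> B" "proj a = proj b" for a b
    using that assms(3) by (metis IntI empty_iff proj_eq_iff vec3_eq_iff)
  show "\<exists>c\<in>crossings D. fst c \<in> A \<and> snd c \<in> B"
  proof (rule ccontr)
    assume no: "\<not> ?thesis"
    have "contractible_off A B"
    proof (rule contractible_off_lift[OF assms(1,2), of "- 1"])
      fix a b assume ab: "a \<in> A" "b \<in> B" "proj a = proj b"
      have "(a, b) \<notin> crossings D" using no ab by force
      then show "- 1 * b $ 3 < - 1 * a $ 3"
        using ab ne[OF ab] assms(4) by (auto simp: crossings_def)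
    qed simp
    then show False using assms(5) by blast
  qed
  show "\<exists>c\<in>crossings D. fst c \<in> B \<and> snd c \<in> A"
  proof (rule ccontr)
    assume no: "\<not> ?thesis"
    have "contractible_off A B"
    proof (rule contractible_off_lift[OF assms(1,2), of 1])
      fix a b assume ab: "a \<in> A" "b \<in> B" "proj a = proj b"
      have "(b, a) \<notin> crossings D" using no ab by force
      then show "1 * b $ 3 < 1 * a $ 3"
        using ab ne[OF ab] assms(4) by (auto simp: crossings_def)
    qed simp
    then show False using assms(5) by blast
  qed
qed

context even_pretzel
begin

lemma adjacent_rings_linked:
  assumes "i < m"
  shows "\<not> contractible_off (ring (Suc i mod m)) (ring i) \<or>
    \<not> contractible_off (ring i) (ring (Suc i mod m))"
proof (cases "Suc i < m")
  case True
  then show ?thesis using ring_next_not_contractible by simp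
next
  case False
  then have "i = m - 1" using assms by simp
  then show ?thesis using ring_last_not_contractible m_ge by simp
qed

text \<open>The indices of the over ring and of the under ring of a crossing form an ordered pair. All \<open>2 m\<close>
  pairs of neighbours occur, and a crossing belongs to one pair only.\<close>

lemma crossings_lower_bound:
  assumes hom: "homeomorphism UNIV UNIV h g" and fin: "finite (crossings (h ` chain))"
  shows "2 * m \<le> card (crossings (h ` chain))"
proof -
  define next_ring where "next_ring i = Suc i mod m" for i
  have nxt: "next_ring i < m" "next_ring i \<noteq> i" "next_ring (next_ring i) \<noteq> i" if "i < m" for i
    using that m_ge by (auto simp: next_ring_def mod_Suc)
  have inj_next: "i = k" if "next_ring i = next_ring k" "i < m" "k < m" for i k
    using that by (auto simp: next_ring_def mod_Suc split: if_splits)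
  define E where "E = (\<lambda>i. (i, next_ring i)) ` {..<m} \<union> (\<lambda>i. (next_ring i, i)) ` {..<m}"
  have "card E = card ((\<lambda>i. (i, next_ring i)) ` {..<m}) + card ((\<lambda>i. (next_ring i, i)) ` {..<m})"
    unfolding E_def using nxt by (intro card_Un_disjoint) auto
  also have "\<dots> = 2 * m" by (simp add: card_image inj_on_def)
  finally have card_E: "card E = 2 * m" .
  have inj_h: "inj h" using hom by (metis UNIV_I homeomorphism_apply1 injI)
  have ex: "\<exists>c\<in>crossings (h ` chain). fst c \<in> h ` ring (fst e) \<and> snd c \<in> h ` ring (snd e)" if "e \<in> E" for e
  proof -
    obtain i where i: "i < m" "e = (i, next_ring i) \<or> e = (next_ring i, i)" using \<open>e \<in> E\<close> by (auto simp: E_def)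
    have ip: "next_ring i < m" using nxt i by blast
    have comp: "compact (h ` ring k)" if "k < m" for k
      using compact_ring[OF that] hom
      by (meson compact_continuous_image continuous_on_subset homeomorphism_cont1 subset_UNIV)
    have "ring i \<inter> ring (next_ring i) = {}" using ring_unique i nxt by blast
    then have disj: "h ` ring i \<inter> h ` ring (next_ring i) = {}" "h ` ring (next_ring i) \<inter> h ` ring i = {}"
      using inj_h by (metis image_Int image_empty Int_commute)+
    have sub: "h ` ring i \<union> h ` ring (next_ring i) \<subseteq> h ` chain" "h ` ring (next_ring i) \<union> h ` ring i \<subseteq> h ` chain"
      using ring_subset_chain i ip by blast+
    have "\<not> contractible_off (h ` ring (next_ring i)) (h ` ring i) \<or>
        \<not> contractible_off (h ` ring i) (h ` ring (next_ring i))"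
      using adjacent_rings_linked[OF i(1)] contractible_off_homeomorphism[OF hom] unfolding next_ring_def by blast
    then show ?thesis
      using i(2) crossings_if_not_contractible_off[OF comp[OF i(1)] comp[OF ip] disj(1) sub(1)]
        crossings_if_not_contractible_off[OF comp[OF ip] comp[OF i(1)] disj(2) sub(2)] by auto
  qed
  then obtain c where c: "\<And>e. e \<in> E \<Longrightarrow> c e \<in> crossings (h ` chain) \<and>
      fst (c e) \<in> h ` ring (fst e) \<and> snd (c e) \<in> h ` ring (snd e)"
    by metis
  have E_less: "fst e < m \<and> snd e < m" if "e \<in> E" for e using that nxt by (auto simp: E_def)
  have uniq: "i = k" if "x \<in> h ` ring i" "x \<in> h ` ring k" "i < m" "k < m" for x i k
    using that ring_unique inj_h by (auto dest: injD)
  have "inj_on c E"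
  proof (rule inj_onI)
    fix e e' assume e: "e \<in> E" "e' \<in> E" "c e = c e'"
    then have "fst e = fst e'" "snd e = snd e'"
      using c[OF e(1)] c[OF e(2)] E_less uniq by metis+
    then show "e = e'" by (simp add: prod_eq_iff)
  qed
  then have "card E \<le> card (crossings (h ` chain))"
    using c fin by (intro card_inj_on_le) auto
  then show ?thesis by (simp add: card_E)
qed

end

section \<open>Minimality and the infinite family\<close>

lemma ambient_isotopic_refl: "ambient_isotopic L L"
proof -
  have "homeomorphism UNIV UNIV (id :: real^3 \<Rightarrow> real^3) id" by (simp add: homeomorphism_def)
  then have "homotopic_with_canon (\<lambda>f. \<exists>g. homeomorphism UNIV UNIV f g) UNIV UNIV (id :: real^3 \<Rightarrow> real^3) id"
    by (auto simp: homotopic_with_refl)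
  then show ?thesis unfolding ambient_isotopic_def by (intro exI[of _ id]) simp
qed

lemma ambient_isotopic_homeomorphism:
  assumes "ambient_isotopic L L'"
  obtains h g where "homeomorphism UNIV UNIV h g" "h ` L = L'"
  using assms homotopic_with_imp_property unfolding ambient_isotopic_def by blast

lemma diagram_finite_crossings: "diagram D \<Longrightarrow> finite (crossings D)"
  by (auto simp: diagram_def regular_position_def)

context even_pretzel
begin

lemma minimal_diagram_chain: "minimal_diagram chain chain"
  unfolding minimal_diagram_def diagram_of_def
proof (intro conjI diagram_chain ambient_isotopic_refl allI impI)
  fix D assume D: "diagram D \<and> ambient_isotopic D chain"
  then obtain h g where hg: "homeomorphism UNIV UNIV h g" "h ` D = chain"
    using ambient_isotopic_homeomorphism by blast
  have hom: "homeomorphism UNIV UNIV g h" using hg(1) by (rule homeomorphism_sym[THEN iffD1])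
  have "g ` chain = D"
    unfolding hg(2)[symmetric] by (simp add: image_image homeomorphism_apply1[OF hg(1)])
  then have "2 * m \<le> card (crossings D)"
    using crossings_lower_bound[OF hom] D diagram_finite_crossings by simp
  then show "card (crossings chain) \<le> card (crossings D)" using crossings_bound by linarith
qed

lemma link_chain: "link chain"
  unfolding link_def using polygonal_link_chain carrier_chain ambient_isotopic_refl by metis

end

text \<open>The lower bound for the image of the first diagram meets the number of crossings of the second one.
  Stating this for homeomorphisms makes it applicable in both directions.\<close>

lemma isotopic_pretzels_imp_le:
  assumes "even_pretzel m" "even_pretzel n"
    and hom: "homeomorphism UNIV UNIV h g" "h ` pretzel (alternating m) = pretzel (alternating n)"
  shows "m \<le> n"
proof -
  interpret M: even_pretzel m by fact
  interpret N: even_pretzel n by fact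
  have "h ` M.chain = N.chain" using hom(2) by (simp add: M.pretzel_eq_chain N.pretzel_eq_chain)
  then have "2 * m \<le> card (crossings N.chain)"
    using M.crossings_lower_bound[OF hom(1)] N.crossings_bound by simp
  then show ?thesis using N.crossings_bound by linarith
qed

lemma isotopic_pretzels_imp_eq:
  assumes "even_pretzel m" "even_pretzel n"
    and "ambient_isotopic (pretzel (alternating m)) (pretzel (alternating n))"
  shows "m = n"
proof -
  obtain h g where hom: "homeomorphism UNIV UNIV h g" "h ` pretzel (alternating m) = pretzel (alternating n)"
    using assms(3) by (rule ambient_isotopic_homeomorphism)
  have inv: "homeomorphism UNIV UNIV g h" using hom(1) by (rule homeomorphism_sym[THEN iffD1])
  have "g ` pretzel (alternating n) = pretzel (alternating m)"
    unfolding hom(2)[symmetric] by (simp add: image_image homeomorphism_apply1[OF hom(1)])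
  then show ?thesis
    using isotopic_pretzels_imp_le[OF assms(1,2) hom] isotopic_pretzels_imp_le[OF assms(2,1) inv] by simp
qed

theorem corollary1p2:
  "\<exists>F :: (real^3) set set.
     infinite F \<and>
     pairwise (\<lambda>L L'. \<not> ambient_isotopic L L') F \<and>
     (\<forall>L\<in>F. pretzel_link L \<and> Z_colorable L \<and>
        (\<exists>D \<gamma>. minimal_diagram D L \<and> Z_coloring D \<gamma> \<and> card (colors D \<gamma>) = 4))"
proof -
  define L where "L n = pretzel (alternating (2 * n + 4))" for n
  have ep: "even_pretzel (2 * n + 4)" for n by unfold_locales auto
  have iso: "n = n'" if "ambient_isotopic (L n) (L n')" for n n'
    using isotopic_pretzels_imp_eq[OF ep ep] that unfolding L_def by fastforce
  have "inj L" using iso ambient_isotopic_refl by (metis injI)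
  then have "infinite (range L)" by (simp add: finite_image_iff)
  moreover have "pairwise (\<lambda>L L'. \<not> ambient_isotopic L L') (range L)"
    using iso by (auto simp: pairwise_def)
  moreover have "pretzel_link (L n) \<and> Z_colorable (L n) \<and>
        (\<exists>D \<gamma>. minimal_diagram D (L n) \<and> Z_coloring D \<gamma> \<and> card (colors D \<gamma>) = 4)" for n
  proof -
    interpret even_pretzel "2 * n + 4" by (rule ep)
    have L: "L n = chain" by (simp add: L_def pretzel_eq_chain)
    have "alternating (2 * n + 4) \<noteq> []" "0 \<notin> set (alternating (2 * n + 4))"
      by (auto simp: alternating_def)
    then have "pretzel_link (L n)"
      unfolding pretzel_link_def L using link_chain ambient_isotopic_refl pretzel_eq_chain by metis
    moreover have card: "card (colors chain arc_color) = 4" by (simp add: colors_arc_color)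
    have "\<not> trivial_coloring chain arc_color"
    proof
      assume "trivial_coloring chain arc_color"
      then have "\<exists>c. colors chain arc_color \<subseteq> {c}"
        unfolding trivial_coloring_def colors_def by blast
      then show False by (auto simp: colors_arc_color)
    qed
    then have "Z_colorable (L n)"
      unfolding Z_colorable_def L diagram_of_def
      using diagram_chain ambient_isotopic_refl Z_coloring_arc_color by blast
    ultimately show ?thesis
      unfolding L using minimal_diagram_chain Z_coloring_arc_color card by blast
  qed
  ultimately show ?thesis by (intro exI[of _ "range L"]) blast
qed

end
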